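(* Let $\mathcal{H}$ be a complex separable Hilbert space and let $\mathbf{C}$ be an antilinear operator in $L^2(\mathcal{H})$. Then the following are equivalent: (1) $\mathbf{C}$ is a conjugation on $L^2(\mathcal{H})$ such that $\mathbf{M}_z\mathbf{C}=\mathbf{C}\,\mathbf{M}_{\bar z}$; (2) there is $\mathbf{C}_0\in L^\infty(LA(\mathcal{H}))$ such that $\mathbf{C}=A_{\mathbf{C}_0}$ and $\mathbf{C}_0(z)$ is a conjugation for almost all $z\in\mathbb{T}$; (3) for any conjugation $J$ in $\mathcal{H}$ there is $\mathbf{U}\in L^\infty(L(\mathcal{H}))$ such that $\mathbf{U}(z)$ is a $J$-symmetric unitary operator for almost all $z\in\mathbb{T}$ and $\mathbf{C}=\widetilde{\mathbf{J}}\,M_{\mathbf{U}}=M_{\mathbf{U}^*}\widetilde{\mathbf{J}}$.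
   Context: $\mathbb{T}$ is the unit circle with normalized Lebesgue measure $m$; $L(\mathcal{H})$ (resp. $LA(\mathcal{H})$) denotes the bounded linear (resp. bounded antilinear) operators on $\mathcal{H}$. A conjugation on a Hilbert space $\mathcal{K}$ is an antilinear map $C:\mathcal{K}\to\mathcal{K}$ with $C^2=I$ and $\langle Cf,Cg\rangle=\langle g,f\rangle$ for all $f,g$. A bounded linear operator $A$ is $C$-symmetric if $CAC=A^*$. $L^2(\mathcal{H})$ is the Hilbert space of (classes of) measurable square-integrable $\mathbf{f}:\mathbb{T}\to\mathcal{H}$ with inner product $\int_{\mathbb{T}}\langle\mathbf{f}(z),\mathbf{g}(z)\rangle dm(z)$. $L^\infty(L(\mathcal{H}))$ (resp. $L^\infty(LA(\mathcal{H}))$) is the space of (classes of) essentially bounded functions $\mathbf{F}$ from $\mathbb{T}$ to $L(\mathcal{H})$ (resp. $LA(\mathcal{H})$) that are measurable, i.e. $z\mapsto\mathbf{F}(z)x$ is measurable for every $x\in\mathcal{H}$. For $\mathbf{F}\in L^\infty(L(\mathcal{H}))$: $(M_{\mathbf{F}}\mathbf{f})(z)=\mathbf{F}(z)\mathbf{f}(z)$ and $\mathbf{F}^*(z)=\mathbf{F}(z)^*$ a.e. For $\mathbf{C}_0\in L^\infty(LA(\mathcal{H}))$: $(A_{\mathbf{C}_0}\mathbf{f})(z)=\mathbf{C}_0(z)\mathbf{f}(z)$ a.e. $(\mathbf{M}_z\mathbf{f})(z)=z\mathbf{f}(z)$, $(\mathbf{M}_{\bar z}\mathbf{f})(z)=\bar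 z\mathbf{f}(z)$. For a conjugation $J$ in $\mathcal{H}$, $\widetilde{\mathbf{J}}$ is the conjugation on $L^2(\mathcal{H})$ given by $(\widetilde{\mathbf{J}}\mathbf{f})(z)=J(\mathbf{f}(z))$ a.e. *)

theory Defs
  imports "HOL-Analysis.Analysis"
begin

section \<open>Complex Hilbert spaces\<close>

text \<open>The inner product is linear in its first argument. Norm, metric and topology are those of
  the underlying real inner product space, whose inner product is the real part of the complex one.\<close>

class complex_inner = real_inner +
  fixes scaleC :: "complex \<Rightarrow> 'a \<Rightarrow> 'a"  (infixr "*\<^sub>C" 75)
    and cinner :: "'a \<Rightarrow> 'a \<Rightarrow> complex"
  assumes scaleC_add_right: "a *\<^sub>C (x + y) = a *\<^sub>C x + a *\<^sub>C y"
    and scaleC_add_left: "(a + b) *\<^sub>C x = a *\<^sub>C x + b *\<^sub>C x"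
    and scaleC_scaleC: "a *\<^sub>C (b *\<^sub>C x) = (a * b) *\<^sub>C x"
    and scaleC_of_real: "complex_of_real r *\<^sub>C x = r *\<^sub>R x"
    and cinner_commute: "cinner x y = cnj (cinner y x)"
    and cinner_add_left: "cinner (x + y) z = cinner x z + cinner y z"
    and cinner_scaleC_left: "cinner (a *\<^sub>C x) y = a * cinner x y"
    and Re_cinner: "Re (cinner x y) = inner x y"

class chilbert_space = complex_inner + complete_space

class separable_chilbert_space = chilbert_space +
  assumes separable: "\<exists>D. countable D \<and> (\<forall>U. open U \<and> U \<noteq> {} \<longrightarrow> D \<inter> U \<noteq> {})"

instance separable_chilbert_space \<subseteq> second_countable_topology
proof
  obtain D :: "'a set" where D: "countable D" "\<And>U. open U \<Longrightarrow> U \<noteq> {} \<Longrightarrow> D \<inter> U \<noteq> {}"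
    using separable[where 'a = 'a] by (elim exE conjE) (blast intro: that)
  define B where "B = (\<lambda>(d, n). ball d (1 / real (Suc n))) ` (D \<times> (UNIV :: nat set))"
  have cB: "countable B"
    unfolding B_def using D(1) by (intro countable_image countable_SIGMA countableI_type)
  have "topological_basis B"
  proof (rule topological_basisI)
    fix b assume "b \<in> B" then show "open b" unfolding B_def by (elim imageE) (simp split: prod.split)
  next
    fix U :: "'a set" and x assume "open U" "x \<in> U"
    then obtain e where e: "e > 0" "ball x e \<subseteq> U" by (meson open_contains_ball)
    obtain n where n: "1 / real (Suc n) < e / 2"
      using e(1) nat_approx_posE[of "e/2"] half_gt_zero by blast
    have "x \<in> ball x (1 / real (Suc n))" by simp
    then have "D \<inter> ball x (1 / real (Suc n)) \<noteq> {}" using D(2)[OF open_ball] by blast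
    then obtain d where d: "d \<in> D" "dist d x < 1 / real (Suc n)"
      by (metis disjoint_iff dist_commute mem_ball)
    have "ball d (1 / real (Suc n)) \<subseteq> ball x e"
    proof
      fix y assume "y \<in> ball d (1 / real (Suc n))"
      then have "dist x y < 1 / real (Suc n) + 1 / real (Suc n)"
        using d(2) dist_triangle[of x y d] by (simp add: dist_commute)
      then show "y \<in> ball x e" using n unfolding mem_ball by linarith
    qed
    with e(2) have "ball d (1 / real (Suc n)) \<subseteq> U" by (rule order_trans[rotated])
    show "\<exists>b\<in>B. x \<in> b \<and> b \<subseteq> U"
    proof (intro bexI conjI)
      show "x \<in> ball d (1 / real (Suc n))" using d(2) unfolding mem_ball .
      show "ball d (1 / real (Suc n)) \<in> B"
        unfolding B_def by (rule image_eqI[of _ _ "(d, n)"]) (use d(1) in simp_all)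
      show "ball d (1 / real (Suc n)) \<subseteq> U" by fact
    qed
  qed
  then have "open = generate_topology B"
    using topological_basis_imp_subbasis by blast
  then show "\<exists>B :: 'a set set. countable B \<and> open = generate_topology B" using cB by blast
qed

lemma scaleC_one [simp]: "1 *\<^sub>C (x :: 'a::complex_inner) = x"
  using scaleC_of_real[of 1 x] by simp

lemma cinner_scaleC_right: "cinner x (a *\<^sub>C y) = cnj a * cinner x (y :: 'a::complex_inner)"
  by (metis cinner_commute cinner_scaleC_left complex_cnj_mult)

lemma cinner_conv_inner: "cinner x y = Complex (inner x y) (inner x (\<i> *\<^sub>C (y :: 'a::complex_inner)))"
  by (rule complex_eqI) (simp_all add: Re_cinner[symmetric] cinner_scaleC_right)

lemma norm_scaleC [simp]: "norm (a *\<^sub>C (x :: 'a::complex_inner)) = cmod a * norm x"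
proof -
  have im: "Im (cinner x x) = 0"
    using arg_cong[OF cinner_commute[of x x], of Im] by simp
  have "inner (a *\<^sub>C x) (a *\<^sub>C x) = (cmod a)\<^sup>2 * inner x x"
    unfolding Re_cinner[symmetric] cinner_scaleC_left cinner_scaleC_right using im
    unfolding cmod_power2 by (simp add: algebra_simps power2_eq_square)
  then show ?thesis
    by (simp add: norm_eq_sqrt_inner real_sqrt_mult)
qed

lemma bounded_linear_scaleC: "bounded_linear (\<lambda>x. a *\<^sub>C (x :: 'a::complex_inner))"
proof (rule bounded_linear_intro)
  show "a *\<^sub>C (x + y) = a *\<^sub>C x + a *\<^sub>C y" for x y :: 'a by (rule scaleC_add_right)
  show "a *\<^sub>C (r *\<^sub>R x) = r *\<^sub>R (a *\<^sub>C x)" for r and x :: 'a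
    by (simp add: scaleC_of_real[symmetric] scaleC_scaleC mult.commute)
  show "norm (a *\<^sub>C x) \<le> norm x * cmod a" for x :: 'a by simp
qed

lemma cinner_ext:
  fixes y z :: "'a::complex_inner"
  assumes "\<And>x. cinner x y = cinner x z" shows "y = z"
proof -
  have "inner x y = inner x z" for x
    using assms[of x] by (metis Re_cinner)
  then have "inner (y - z) (y - z) = 0" by (simp add: inner_diff_right)
  then show ?thesis by simp
qed

section \<open>Operators\<close>

definition bounded_clinear :: "('a::complex_inner \<Rightarrow> 'b::complex_inner) \<Rightarrow> bool" where
  "bounded_clinear A \<longleftrightarrow> bounded_linear A \<and> (\<forall>a x. A (a *\<^sub>C x) = a *\<^sub>C A x)"

definition antilinear :: "('a::complex_inner \<Rightarrow> 'b::complex_inner) \<Rightarrow> bool" where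
  "antilinear A \<longleftrightarrow> (\<forall>x y. A (x + y) = A x + A y) \<and> (\<forall>a x. A (a *\<^sub>C x) = cnj a *\<^sub>C A x)"

definition bounded_antilinear :: "('a::complex_inner \<Rightarrow> 'b::complex_inner) \<Rightarrow> bool" where
  "bounded_antilinear A \<longleftrightarrow> antilinear A \<and> (\<exists>K. \<forall>x. norm (A x) \<le> K * norm x)"

definition conjugation :: "('a::complex_inner \<Rightarrow> 'a) \<Rightarrow> bool" where
  "conjugation C \<longleftrightarrow> antilinear C \<and> C \<circ> C = id \<and> (\<forall>f g. cinner (C f) (C g) = cinner g f)"

text \<open>On a Hilbert space the adjoint of a bounded operator exists; see \<open>cinner_cadjoint\<close> below.\<close>

definition cadjoint :: "('a::complex_inner \<Rightarrow> 'b::complex_inner) \<Rightarrow> 'b \<Rightarrow> 'a" where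
  "cadjoint A = (THE B. \<forall>x y. cinner (A x) y = cinner x (B y))"

definition unitary_op :: "('a::complex_inner \<Rightarrow> 'a) \<Rightarrow> bool" where
  "unitary_op U \<longleftrightarrow> bounded_clinear U \<and> cadjoint U \<circ> U = id \<and> U \<circ> cadjoint U = id"

definition C_symmetric :: "('a::complex_inner \<Rightarrow> 'a) \<Rightarrow> ('a \<Rightarrow> 'a) \<Rightarrow> bool" where
  "C_symmetric C A \<longleftrightarrow> bounded_clinear A \<and> C \<circ> A \<circ> C = cadjoint A"

lemma bounded_antilinear_imp_bounded_linear:
  assumes "bounded_antilinear A" shows "bounded_linear A"
proof -
  from assms obtain K where K: "\<And>x. norm (A x) \<le> K * norm x"
    and A: "\<And>x y. A (x + y) = A x + A y" "\<And>a x. A (a *\<^sub>C x) = cnj a *\<^sub>C A x"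
    unfolding bounded_antilinear_def antilinear_def by blast
  show ?thesis
  proof (rule bounded_linear_intro)
    show "A (x + y) = A x + A y" for x y by (rule A)
    show "A (r *\<^sub>R x) = r *\<^sub>R A x" for r x
      using A(2)[of "of_real r" x] by (simp add: scaleC_of_real)
    show "norm (A x) \<le> norm x * K" for x using K[of x] by (simp add: mult.commute)
  qed
qed

lemma conjugation_norm: "conjugation C \<Longrightarrow> norm (C x) = norm x"
  unfolding conjugation_def norm_eq_sqrt_inner Re_cinner[symmetric] by simp

lemma conjugation_imp_bounded_antilinear: "conjugation C \<Longrightarrow> bounded_antilinear C"
  unfolding bounded_antilinear_def
  by (metis conjugation_def conjugation_norm mult_1 order_refl)

lemma real_riesz:
  fixes f :: "'a::{real_inner, complete_space} \<Rightarrow> real"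
  assumes "bounded_linear f"
  shows "\<exists>y. \<forall>x. f x = inner x y"
proof -
  interpret f: bounded_linear f by fact
  obtain K where K: "\<And>x. norm (f x) \<le> norm x * K" using f.bounded by blast
  define q where "q x = (norm x)\<^sup>2 / 2 - f x" for x
  have lb: "- (K\<^sup>2) / 2 \<le> q x" for x
  proof -
    have "f x \<le> norm x * K" using K[of x] by auto
    moreover have "0 \<le> (norm x - K)\<^sup>2" by simp
    ultimately show ?thesis unfolding q_def power2_diff by (simp add: field_simps)
  qed
  define m where "m = (INF x. q x)"
  have bdd: "bdd_below (range q)" by (rule bdd_belowI[of _ "- (K\<^sup>2) / 2"]) (use lb in auto)
  have m_le: "m \<le> q x" for x unfolding m_def by (rule cINF_lower[OF bdd]) simp
  have "\<exists>x. q x < m + 1 / real (Suc n)" for n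
  proof -
    have "(INF x. q x) < m + 1 / real (Suc n)" unfolding m_def[symmetric] by simp
    then show ?thesis by (subst (asm) cINF_less_iff[OF _ bdd]) auto
  qed
  then obtain X where X: "\<And>n. q (X n) < m + 1 / real (Suc n)" by metis
  have par: "(norm (x - y))\<^sup>2 \<le> 4 * ((q x - m) + (q y - m))" for x y
  proof -
    have "q ((1/2) *\<^sub>R (x + y)) = (q x + q y) / 2 - (norm (x - y))\<^sup>2 / 8"
      unfolding q_def f.scaleR f.add
      by (simp add: power2_norm_eq_inner inner_add_left inner_add_right inner_diff_left
          inner_diff_right inner_commute field_simps)
    with m_le[of "(1/2) *\<^sub>R (x + y)"] show ?thesis by (simp add: field_simps)
  qed
  have "Cauchy X"
  proof (rule metric_CauchyI)
    fix e :: real assume e: "0 < e"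
    then obtain N where N: "1 / real (Suc N) < e\<^sup>2 / 8" using nat_approx_posE[of "e\<^sup>2/8"] by auto
    have *: "q (X n) - m < e\<^sup>2 / 8" if "n \<ge> N" for n
    proof -
      have "1 / real (Suc n) \<le> 1 / real (Suc N)" using that by (simp add: frac_le)
      then show ?thesis using X[of n] N by linarith
    qed
    have "dist (X i) (X j) < e" if "i \<ge> N" "j \<ge> N" for i j
    proof -
      have "(norm (X i - X j))\<^sup>2 < e\<^sup>2" using par[of "X i" "X j"] *[OF that(1)] *[OF that(2)] by (simp add: field_simps)
      then show ?thesis using e unfolding dist_norm by (intro power2_less_imp_less[of _ e]) auto
    qed
    then show "\<exists>M. \<forall>m\<ge>M. \<forall>n\<ge>M. dist (X m) (X n) < e" by blast
  qed
  then obtain y where y: "X \<longlonglongrightarrow> y" using Cauchy_convergent convergent_def by blast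
  have "(\<lambda>n. q (X n)) \<longlonglongrightarrow> q y"
    unfolding q_def by (intro tendsto_intros y f.tendsto) simp
  moreover have "(\<lambda>n. m + 1 / real (Suc n)) \<longlonglongrightarrow> m + 0"
    by (intro tendsto_intros LIMSEQ_Suc[OF lim_1_over_n])
  ultimately have "q y \<le> m + 0"
    by (rule LIMSEQ_le) (use X in \<open>auto intro: less_imp_le\<close>)
  then have ymin: "q y \<le> q z" for z using m_le[of z] by simp
  have "f h = inner h y" for h
  proof (rule ccontr)
    define d where "d = inner h y - f h"
    assume "f h \<noteq> inner h y"
    then have d: "d \<noteq> 0" by (simp add: d_def)
    have h: "0 \<le> t * d + t\<^sup>2 * (norm h)\<^sup>2 / 2" for t
    proof -
      have "q (y + t *\<^sub>R h) = q y + (t * d + t\<^sup>2 * (norm h)\<^sup>2 / 2)"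
        unfolding q_def d_def f.scaleR f.add power2_norm_eq_inner
        by (simp add: inner_add_left inner_add_right inner_commute[of y h] field_simps power2_eq_square)
      then show ?thesis using ymin[of "y + t *\<^sub>R h"] by simp
    qed
    define N where "N = (norm h)\<^sup>2 + 1"
    have N: "N > 0" unfolding N_def by (intro add_nonneg_pos) auto
    have "(d / N)\<^sup>2 * (norm h)\<^sup>2 \<le> (d / N)\<^sup>2 * N" by (intro mult_left_mono) (auto simp: N_def)
    also have "\<dots> = d\<^sup>2 / N" using N by (simp add: power2_eq_square field_simps)
    finally have "(d / N)\<^sup>2 * (norm h)\<^sup>2 \<le> d\<^sup>2 / N" .
    moreover have "d\<^sup>2 / N \<le> (d / N)\<^sup>2 * (norm h)\<^sup>2 / 2"
      using h[of "- d / N"] by (simp add: power2_eq_square)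
    ultimately have "d\<^sup>2 / N \<le> d\<^sup>2 / N / 2"
      by (meson divide_right_mono order_trans zero_le_numeral)
    moreover have "d\<^sup>2 / N > 0" using d N by simp
    moreover have "c \<le> c / 2 \<Longrightarrow> 0 < c \<Longrightarrow> False" for c :: real by linarith
    ultimately show False by blast
  qed
  then show ?thesis by blast
qed

lemma cinner_cadjoint:
  fixes A :: "'a::chilbert_space \<Rightarrow> 'b::complex_inner"
  assumes "bounded_clinear A"
  shows "cinner (A x) y = cinner x (cadjoint A y)"
proof -
  have bl: "bounded_linear A" and sc: "\<And>a x. A (a *\<^sub>C x) = a *\<^sub>C A x"
    using assms by (auto simp: bounded_clinear_def)
  have "\<exists>z. \<forall>x. inner (A x) y = inner x z" for y
    by (rule real_riesz) (rule bounded_linear_compose[OF bounded_linear_inner_left bl])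
  then obtain B where B: "\<And>x y. inner (A x) y = inner x (B y)" by metis
  have "cinner (A x) y = cinner x (B y)" for x y
  proof (rule complex_eqI)
    show "Re (cinner (A x) y) = Re (cinner x (B y))" by (simp add: Re_cinner B)
    have "Re (cinner (A (- \<i> *\<^sub>C x)) y) = Re (cinner (- \<i> *\<^sub>C x) (B y))"
      unfolding Re_cinner by (rule B)
    then show "Im (cinner (A x) y) = Im (cinner x (B y))"
      unfolding sc cinner_scaleC_left by simp
  qed
  then have B': "\<forall>x y. cinner (A x) y = cinner x (B y)" by blast
  have "cadjoint A = B"
    unfolding cadjoint_def
  proof (rule the_equality)
    show "\<forall>x y. cinner (A x) y = cinner x (B y)" by (rule B')
  next
    fix B2 assume B2: "\<forall>x y. cinner (A x) y = cinner x (B2 y)"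
    show "B2 = B"
      by (rule ext, rule cinner_ext) (simp add: B2[rule_format, symmetric] B'[rule_format, symmetric])
  qed
  then show ?thesis using B' by simp
qed

section \<open>The unit circle and the space of square-integrable functions\<close>

text \<open>Normalized Lebesgue measure on the unit circle: the completed image of the uniform
  distribution on the interval of angles.\<close>

definition circle_measure :: "complex measure" where
  "circle_measure = completion
     (distr (uniform_measure lborel {0..<2 * pi}) (restrict_space borel (sphere 0 1)) cis)"

definition square_integrable :: "(complex \<Rightarrow> 'h::separable_chilbert_space) \<Rightarrow> bool" where
  "square_integrable f \<longleftrightarrow> f \<in> borel_measurable circle_measure \<and>
     integrable circle_measure (\<lambda>z. (norm (f z))\<^sup>2)"

lemma space_circle_measure [simp]: "space circle_measure = sphere 0 1"
  by (simp add: circle_measure_def space_restrict_space)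

lemma measurable_cis: "cis \<in> uniform_measure lborel {0..<2 * pi} \<rightarrow>\<^sub>M restrict_space borel (sphere 0 1)"
proof (rule measurable_restrict_space2)
  have "cis \<in> borel_measurable borel"
    by (intro borel_measurable_continuous_onI continuous_on_cis continuous_on_id)
  then show "cis \<in> borel_measurable (uniform_measure lborel {0..<2 * pi})"
    by (simp cong: measurable_cong_sets)
qed auto

lemma emeasure_circle_measure: "emeasure circle_measure (sphere 0 1) = 1"
proof -
  let ?U = "uniform_measure lborel {0..<2 * pi}"
  let ?R = "restrict_space borel (sphere 0 1 :: complex set)"
  have s: "sphere 0 1 \<in> sets ?R" by (auto simp: sets_restrict_space)
  have "emeasure circle_measure (sphere 0 1) = emeasure (distr ?U ?R cis) (sphere 0 1)"
    unfolding circle_measure_def using s by (simp add: emeasure_completion)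
  also have "\<dots> = emeasure ?U UNIV"
    by (subst emeasure_distr[OF measurable_cis s]) (auto simp: vimage_def)
  also have "\<dots> = 1"
    by (subst emeasure_uniform_measure) (auto intro!: divide_self_if simp: ennreal_divide_self)
  finally show ?thesis .
qed

lemma borel_measurable_circle:
  "f \<in> borel_measurable borel \<Longrightarrow> f \<in> borel_measurable circle_measure"
  unfolding circle_measure_def
  by (intro measurable_completion) (simp add: measurable_restrict_space1 cong: measurable_cong_sets)

text \<open>Elements are almost-everywhere classes of square-integrable functions on the circle.\<close>

quotient_type (overloaded) 'h L2 = "complex \<Rightarrow> 'h::separable_chilbert_space" / partial:
  "\<lambda>f g. square_integrable f \<and> square_integrable g \<and> (AE z in circle_measure. f z = g z)"
  morphisms rep_L2 abs_L2
proof (rule part_equivpI)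
  show "\<exists>f::complex \<Rightarrow> 'h. square_integrable f \<and> square_integrable f \<and> (AE z in circle_measure. f z = f z)"
    by (rule exI[of _ "\<lambda>_. 0"]) (simp add: square_integrable_def)
  show "symp (\<lambda>(f::complex \<Rightarrow> 'h) g. square_integrable f \<and> square_integrable g \<and>
      (AE z in circle_measure. f z = g z))"
    by (rule sympI) (simp add: eq_commute)
  show "transp (\<lambda>(f::complex \<Rightarrow> 'h) g. square_integrable f \<and> square_integrable g \<and>
      (AE z in circle_measure. f z = g z))"
  proof (rule transpI, elim conjE, intro conjI)
    fix f g h :: "complex \<Rightarrow> 'h"
    assume "AE z in circle_measure. f z = g z" "AE z in circle_measure. g z = h z"
    then show "AE z in circle_measure. f z = h z" by eventually_elim simp
  qed
qed


lemma square_integrable_rep_L2 [simp]: "square_integrable (rep_L2 f)"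
  using Quotient3_rep_reflp[OF Quotient3_L2, of f] by simp

lemma abs_rep_L2 [simp]: "abs_L2 (rep_L2 f) = f"
  by (rule Quotient3_abs_rep[OF Quotient3_L2])

lemma abs_L2_eq_iff:
  assumes "square_integrable f" "square_integrable g"
  shows "abs_L2 f = abs_L2 g \<longleftrightarrow> (AE z in circle_measure. f z = g z)"
  using Quotient3_rel[OF Quotient3_L2, of f g] assms by auto

lemma rep_abs_L2:
  assumes "square_integrable f"
  shows "AE z in circle_measure. rep_L2 (abs_L2 f) z = f z"
  using abs_L2_eq_iff[of "rep_L2 (abs_L2 f)" f] assms by simp

lemma L2_eqI: "(AE z in circle_measure. rep_L2 f z = rep_L2 g z) \<Longrightarrow> f = g"
  using abs_L2_eq_iff[of "rep_L2 f" "rep_L2 g"] by simp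

lemma square_integrable_measurable [measurable_dest]:
  "square_integrable f \<Longrightarrow> f \<in> borel_measurable circle_measure"
  by (simp add: square_integrable_def)

lemma square_integrable_bound:
  assumes "g \<in> borel_measurable circle_measure" "square_integrable f"
    and "AE z in circle_measure. norm (g z) \<le> K * norm (f z)"
  shows "square_integrable g"
  unfolding square_integrable_def
proof
  note [measurable] = assms(1)
  show "integrable circle_measure (\<lambda>z. (norm (g z))\<^sup>2)"
  proof (rule Bochner_Integration.integrable_bound)
    show "integrable circle_measure (\<lambda>z. K\<^sup>2 * (norm (f z))\<^sup>2)"
      using assms(2) by (auto simp: square_integrable_def)
    show "AE z in circle_measure. norm ((norm (g z))\<^sup>2) \<le> norm (K\<^sup>2 * (norm (f z))\<^sup>2)"
      using assms(3)
    proof eventually_elim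
      case (elim z)
      have "(norm (g z))\<^sup>2 \<le> (K * norm (f z))\<^sup>2" by (intro power_mono elim) simp
      then show ?case by (simp add: power_mult_distrib)
    qed
  qed measurable
qed (rule assms(1))

lemma square_integrable_0: "square_integrable (\<lambda>_. 0)"
  by (simp add: square_integrable_def)

lemma square_integrable_add:
  assumes f: "square_integrable f" and g: "square_integrable g"
  shows "square_integrable (\<lambda>z. f z + g z)"
  unfolding square_integrable_def
proof
  note [measurable] = f[THEN square_integrable_measurable] g[THEN square_integrable_measurable]
  show "integrable circle_measure (\<lambda>z. (norm (f z + g z))\<^sup>2)"
  proof (rule Bochner_Integration.integrable_bound)
    show "integrable circle_measure (\<lambda>z. 2 * (norm (f z))\<^sup>2 + 2 * (norm (g z))\<^sup>2)"
      using f g by (auto simp: square_integrable_def)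
    have "(norm (x + y))\<^sup>2 \<le> 2 * (norm x)\<^sup>2 + 2 * (norm y)\<^sup>2" for x y :: 'a
      using inner_ge_zero[of "x - y"]
      by (simp add: power2_norm_eq_inner inner_add_left inner_add_right inner_diff_left
          inner_diff_right inner_commute)
    then show "AE z in circle_measure. norm ((norm (f z + g z))\<^sup>2)
        \<le> norm (2 * (norm (f z))\<^sup>2 + 2 * (norm (g z))\<^sup>2)"
      by simp
  qed measurable
qed (use f g in \<open>auto intro: square_integrable_measurable\<close>)

lemma measurable_scaleC:
  "f \<in> borel_measurable M \<Longrightarrow> (\<lambda>z. a *\<^sub>C (f z :: 'h::separable_chilbert_space)) \<in> borel_measurable M"
  by (rule borel_measurable_continuous_on)
    (rule linear_continuous_on[OF bounded_linear_scaleC])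

lemma square_integrable_scaleC: "square_integrable f \<Longrightarrow> square_integrable (\<lambda>z. a *\<^sub>C f z)"
  by (rule square_integrable_bound[of _ f "cmod a"])
    (auto intro: measurable_scaleC square_integrable_measurable)

lemma square_integrable_scaleR: "square_integrable f \<Longrightarrow> square_integrable (\<lambda>z. r *\<^sub>R f z)"
  using square_integrable_scaleC[of f "of_real r"] by (simp add: scaleC_of_real)

lemma square_integrable_uminus: "square_integrable f \<Longrightarrow> square_integrable (\<lambda>z. - f z)"
  using square_integrable_scaleR[of f "-1"] by simp

lemma square_integrable_diff:
  "square_integrable f \<Longrightarrow> square_integrable g \<Longrightarrow> square_integrable (\<lambda>z. f z - g z)"
  using square_integrable_add[of f "\<lambda>z. - g z"] square_integrable_uminus[of g] by simp

lemma integrable_inner: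
  assumes f: "square_integrable f" and g: "square_integrable g"
  shows "integrable circle_measure (\<lambda>z. inner (f z) (g z))"
proof (rule Bochner_Integration.integrable_bound)
  note [measurable] = f[THEN square_integrable_measurable] g[THEN square_integrable_measurable]
  show "integrable circle_measure (\<lambda>z. (norm (f z))\<^sup>2 + (norm (g z))\<^sup>2)"
    using f g by (auto simp: square_integrable_def)
  have "\<bar>inner x y\<bar> \<le> (norm x)\<^sup>2 + (norm y)\<^sup>2" for x y :: 'a
  proof -
    have "\<bar>inner x y\<bar> \<le> norm x * norm y" by (rule Cauchy_Schwarz_ineq2)
    also have "2 * (norm x * norm y) \<le> (norm x)\<^sup>2 + (norm y)\<^sup>2"
      using sum_squares_bound[of "norm x" "norm y"] by simp
    then have "norm x * norm y \<le> (norm x)\<^sup>2 + (norm y)\<^sup>2"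
      using mult_nonneg_nonneg[OF norm_ge_zero[of x] norm_ge_zero[of y]] by linarith
    finally show ?thesis .
  qed
  then show "AE z in circle_measure. norm (inner (f z) (g z)) \<le> norm ((norm (f z))\<^sup>2 + (norm (g z))\<^sup>2)"
    by simp
  show "(\<lambda>z. inner (f z) (g z)) \<in> borel_measurable circle_measure" by measurable
qed

lemma integrable_cinner:
  assumes "square_integrable f" "square_integrable g"
  shows "integrable circle_measure (\<lambda>z. cinner (f z) (g z))"
  unfolding cinner_conv_inner complex_of_real_def[symmetric] Complex_eq
  using integrable_inner[OF assms] integrable_inner[OF assms(1) square_integrable_scaleC[OF assms(2), of \<i>]]
  by (intro Bochner_Integration.integrable_add integrable_mult_right integrable_of_real)

instantiation L2 :: (separable_chilbert_space) real_vector
begin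

definition "0 = abs_L2 (\<lambda>_. 0)"
definition "f + g = abs_L2 (\<lambda>z. rep_L2 f z + rep_L2 g z)"
definition "- f = abs_L2 (\<lambda>z. - rep_L2 f z)"
definition "f - g = abs_L2 (\<lambda>z. rep_L2 f z - rep_L2 g z)"
definition "r *\<^sub>R f = abs_L2 (\<lambda>z. r *\<^sub>R rep_L2 f z)"

lemma rep_L2_0: "AE z in circle_measure. rep_L2 0 z = 0"
  unfolding zero_L2_def by (intro rep_abs_L2 square_integrable_0)

lemma rep_L2_add: "AE z in circle_measure. rep_L2 (f + g) z = rep_L2 f z + rep_L2 g z"
  unfolding plus_L2_def by (intro rep_abs_L2 square_integrable_add square_integrable_rep_L2)

lemma rep_L2_uminus: "AE z in circle_measure. rep_L2 (- f) z = - rep_L2 f z"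
  unfolding uminus_L2_def by (intro rep_abs_L2 square_integrable_uminus square_integrable_rep_L2)

lemma rep_L2_diff: "AE z in circle_measure. rep_L2 (f - g) z = rep_L2 f z - rep_L2 g z"
  unfolding minus_L2_def by (intro rep_abs_L2 square_integrable_diff square_integrable_rep_L2)

lemma rep_L2_scaleR: "AE z in circle_measure. rep_L2 (r *\<^sub>R f) z = r *\<^sub>R rep_L2 f z"
  unfolding scaleR_L2_def by (intro rep_abs_L2 square_integrable_scaleR square_integrable_rep_L2)

instance
proof
  fix f g h :: "'a L2" and r s :: real
  show "f + g + h = f + (g + h)"
    by (rule L2_eqI, use rep_L2_add[of "f + g" h] rep_L2_add[of f g] rep_L2_add[of f "g + h"]
        rep_L2_add[of g h] in eventually_elim) (simp add: add.assoc)
  show "f + g = g + f" by (simp add: plus_L2_def add.commute)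
  show "0 + f = f"
    by (rule L2_eqI, use rep_L2_add[of 0 f] rep_L2_0 in eventually_elim) simp
  show "- f + f = 0"
    by (rule L2_eqI, use rep_L2_add[of "- f" f] rep_L2_uminus[of f] rep_L2_0 in eventually_elim) simp
  show "f - g = f + - g"
    by (rule L2_eqI, use rep_L2_add[of f "- g"] rep_L2_uminus[of g] rep_L2_diff[of f g]
        in eventually_elim) simp
  show "r *\<^sub>R (f + g) = r *\<^sub>R f + r *\<^sub>R g"
    by (rule L2_eqI, use rep_L2_scaleR[of r "f + g"] rep_L2_add[of f g] rep_L2_scaleR[of r f]
        rep_L2_scaleR[of r g] rep_L2_add[of "r *\<^sub>R f" "r *\<^sub>R g"] in eventually_elim)
      (simp add: scaleR_add_right)
  show "(r + s) *\<^sub>R f = r *\<^sub>R f + s *\<^sub>R f"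
    by (rule L2_eqI, use rep_L2_scaleR[of "r + s" f] rep_L2_scaleR[of r f] rep_L2_scaleR[of s f]
        rep_L2_add[of "r *\<^sub>R f" "s *\<^sub>R f"] in eventually_elim) (simp add: scaleR_add_left)
  show "r *\<^sub>R s *\<^sub>R f = (r * s) *\<^sub>R f"
    by (rule L2_eqI, use rep_L2_scaleR[of r "s *\<^sub>R f"] rep_L2_scaleR[of s f]
        rep_L2_scaleR[of "r * s" f] in eventually_elim) simp
  show "1 *\<^sub>R f = f" by (simp add: scaleR_L2_def)
qed

end

instantiation L2 :: (separable_chilbert_space) complex_inner
begin

definition "a *\<^sub>C f = abs_L2 (\<lambda>z. a *\<^sub>C rep_L2 f z)"
definition "inner f g = (LINT z|circle_measure. inner (rep_L2 f z) (rep_L2 g z))"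
definition "cinner f g = (LINT z|circle_measure. cinner (rep_L2 f z) (rep_L2 g z))"
definition "norm f = sqrt (inner f (f :: 'a L2))"
definition "sgn f = f /\<^sub>R norm (f :: 'a L2)"
definition "dist f g = norm (f - (g :: 'a L2))"
definition [code del]:
  "(uniformity :: ('a L2 \<times> 'a L2) filter) = (INF e\<in>{0<..}. principal {(f, g). dist f g < e})"
definition [code del]:
  "open (S :: 'a L2 set) = (\<forall>f\<in>S. \<forall>\<^sub>F (f', g) in uniformity. f' = f \<longrightarrow> g \<in> S)"

lemma rep_L2_scaleC: "AE z in circle_measure. rep_L2 (a *\<^sub>C f) z = a *\<^sub>C rep_L2 f z"
  unfolding scaleC_L2_def by (intro rep_abs_L2 square_integrable_scaleC square_integrable_rep_L2)

lemma L2_inner_add_left: "inner (f + g) h = inner f h + inner g (h :: 'a L2)"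
proof -
  have "inner (f + g) h = (LINT z|circle_measure. inner (rep_L2 f z) (rep_L2 h z) + inner (rep_L2 g z) (rep_L2 h z))"
    unfolding inner_L2_def
  proof (rule integral_cong_AE)
    show "AE z in circle_measure. inner (rep_L2 (f + g) z) (rep_L2 h z) =
        inner (rep_L2 f z) (rep_L2 h z) + inner (rep_L2 g z) (rep_L2 h z)"
      using rep_L2_add[of f g] by eventually_elim (simp add: inner_add_left)
  qed (intro borel_measurable_integrable Bochner_Integration.integrable_add integrable_inner square_integrable_rep_L2)+
  then show ?thesis by (simp add: inner_L2_def integrable_inner)
qed

lemma L2_inner_scaleR_left: "inner (r *\<^sub>R f) h = r * inner f (h :: 'a L2)"
proof -
  have "inner (r *\<^sub>R f) h = (LINT z|circle_measure. r * inner (rep_L2 f z) (rep_L2 h z))"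
    unfolding inner_L2_def
  proof (rule integral_cong_AE)
    show "AE z in circle_measure. inner (rep_L2 (r *\<^sub>R f) z) (rep_L2 h z) =
        r * inner (rep_L2 f z) (rep_L2 h z)"
      using rep_L2_scaleR[of r f] by eventually_elim simp
  qed (intro borel_measurable_integrable integrable_mult_right integrable_inner square_integrable_rep_L2)+
  then show ?thesis by (simp add: inner_L2_def)
qed

lemma L2_cinner_add_left: "cinner (f + g) h = cinner f h + cinner g (h :: 'a L2)"
proof -
  have "cinner (f + g) h = (LINT z|circle_measure. cinner (rep_L2 f z) (rep_L2 h z) + cinner (rep_L2 g z) (rep_L2 h z))"
    unfolding cinner_L2_def
  proof (rule integral_cong_AE)
    show "AE z in circle_measure. cinner (rep_L2 (f + g) z) (rep_L2 h z) =
        cinner (rep_L2 f z) (rep_L2 h z) + cinner (rep_L2 g z) (rep_L2 h z)"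
      using rep_L2_add[of f g] by eventually_elim (simp add: cinner_add_left)
  qed (intro borel_measurable_integrable Bochner_Integration.integrable_add integrable_cinner square_integrable_rep_L2)+
  then show ?thesis by (simp add: cinner_L2_def integrable_cinner)
qed

lemma L2_cinner_scaleC_left: "cinner (a *\<^sub>C f) h = a * cinner f (h :: 'a L2)"
proof -
  have "cinner (a *\<^sub>C f) h = (LINT z|circle_measure. a * cinner (rep_L2 f z) (rep_L2 h z))"
    unfolding cinner_L2_def
  proof (rule integral_cong_AE)
    show "AE z in circle_measure. cinner (rep_L2 (a *\<^sub>C f) z) (rep_L2 h z) =
        a * cinner (rep_L2 f z) (rep_L2 h z)"
      using rep_L2_scaleC[of a f] by eventually_elim (simp add: cinner_scaleC_left)
  qed (intro borel_measurable_integrable integrable_mult_right integrable_cinner square_integrable_rep_L2)+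
  then show ?thesis by (simp add: cinner_L2_def)
qed

lemma L2_inner_self_eq_0: "inner f f = 0 \<longleftrightarrow> f = (0 :: 'a L2)"
proof -
  have "inner f f = 0 \<longleftrightarrow> (AE z in circle_measure. inner (rep_L2 f z) (rep_L2 f z) = 0)"
    unfolding inner_L2_def
    by (intro integral_nonneg_eq_0_iff_AE) (auto intro: integrable_inner)
  also have "\<dots> \<longleftrightarrow> (AE z in circle_measure. rep_L2 f z = 0)" by simp
  also have "\<dots> \<longleftrightarrow> f = 0"
    using abs_L2_eq_iff[OF square_integrable_rep_L2 square_integrable_0, of f]
    by (simp add: zero_L2_def)
  finally show ?thesis .
qed

instance
proof
  fix f g h :: "'a L2" and r s :: real and a b :: complex
  show "sgn f = f /\<^sub>R norm f" by (rule sgn_L2_def)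
  show "dist f g = norm (f - g)" by (rule dist_L2_def)
  show "(uniformity :: ('a L2 \<times> 'a L2) filter) = (INF e\<in>{0<..}. principal {(f, g). dist f g < e})"
    by (rule uniformity_L2_def)
  show "open S = (\<forall>f\<in>S. \<forall>\<^sub>F (f', g) in uniformity. f' = f \<longrightarrow> g \<in> S)" for S :: "'a L2 set"
    by (rule open_L2_def)
  show "inner f g = inner g f" by (simp add: inner_L2_def inner_commute)
  show "inner (f + g) h = inner f h + inner g h" by (rule L2_inner_add_left)
  show "inner (r *\<^sub>R f) g = r * inner f g" by (rule L2_inner_scaleR_left)
  show "0 \<le> inner f f" by (simp add: inner_L2_def)
  show "inner f f = 0 \<longleftrightarrow> f = 0" by (rule L2_inner_self_eq_0)
  show "norm f = sqrt (inner f f)" by (rule norm_L2_def)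
  show "a *\<^sub>C (f + g) = a *\<^sub>C f + a *\<^sub>C g"
    by (rule L2_eqI, use rep_L2_scaleC[of a "f + g"] rep_L2_add[of f g] rep_L2_scaleC[of a f]
        rep_L2_scaleC[of a g] rep_L2_add[of "a *\<^sub>C f" "a *\<^sub>C g"] in eventually_elim)
      (simp add: scaleC_add_right)
  show "(a + b) *\<^sub>C f = a *\<^sub>C f + b *\<^sub>C f"
    by (rule L2_eqI, use rep_L2_scaleC[of "a + b" f] rep_L2_scaleC[of a f] rep_L2_scaleC[of b f]
        rep_L2_add[of "a *\<^sub>C f" "b *\<^sub>C f"] in eventually_elim) (simp add: scaleC_add_left)
  show "a *\<^sub>C b *\<^sub>C f = (a * b) *\<^sub>C f"
    by (rule L2_eqI, use rep_L2_scaleC[of a "b *\<^sub>C f"] rep_L2_scaleC[of b f]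
        rep_L2_scaleC[of "a * b" f] in eventually_elim) (simp add: scaleC_scaleC)
  show "complex_of_real r *\<^sub>C f = r *\<^sub>R f"
    by (simp add: scaleC_L2_def scaleR_L2_def scaleC_of_real)
  show "cinner f g = cnj (cinner g f)"
    unfolding cinner_L2_def Bochner_Integration.integral_cnj[symmetric] by (subst cinner_commute) simp
  show "cinner (f + g) h = cinner f h + cinner g h" by (rule L2_cinner_add_left)
  show "cinner (a *\<^sub>C f) g = a * cinner f g" by (rule L2_cinner_scaleC_left)
  show "Re (cinner f g) = inner f g"
    unfolding cinner_L2_def inner_L2_def
    by (subst integral_Re[symmetric]) (auto intro: integrable_cinner simp: Re_cinner)
qed

end

section \<open>Operator-valued essentially bounded functions\<close>

text \<open>Members are representatives of the almost-everywhere classes.\<close>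

definition Linf_L :: "(complex \<Rightarrow> 'h::separable_chilbert_space \<Rightarrow> 'h) \<Rightarrow> bool" where
  "Linf_L F \<longleftrightarrow> (\<forall>z\<in>sphere 0 1. bounded_clinear (F z)) \<and>
     (\<forall>x. (\<lambda>z. F z x) \<in> borel_measurable circle_measure) \<and>
     (\<exists>K. AE z in circle_measure. onorm (F z) \<le> K)"

definition Linf_LA :: "(complex \<Rightarrow> 'h::separable_chilbert_space \<Rightarrow> 'h) \<Rightarrow> bool" where
  "Linf_LA F \<longleftrightarrow> (\<forall>z\<in>sphere 0 1. bounded_antilinear (F z)) \<and>
     (\<forall>x. (\<lambda>z. F z x) \<in> borel_measurable circle_measure) \<and>
     (\<exists>K. AE z in circle_measure. onorm (F z) \<le> K)"

text \<open>The operator acting by \<open>(pointwise_op F f)(z) = F(z) f(z)\<close> almost everywhere, for a linear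
  or an antilinear operator-valued function \<open>F\<close>; \<open>rep_pointwise_op\<close> below shows that it is well
  defined on all of the space when \<open>F\<close> is essentially bounded.\<close>

definition pointwise_op :: "(complex \<Rightarrow> 'h::separable_chilbert_space \<Rightarrow> 'h) \<Rightarrow> 'h L2 \<Rightarrow> 'h L2" where
  "pointwise_op F f = abs_L2 (\<lambda>z. F z (rep_L2 f z))"

definition M_z :: "'h::separable_chilbert_space L2 \<Rightarrow> 'h L2" where
  "M_z = pointwise_op (\<lambda>z x. z *\<^sub>C x)"

definition M_cnj_z :: "'h::separable_chilbert_space L2 \<Rightarrow> 'h L2" where
  "M_cnj_z = pointwise_op (\<lambda>z x. cnj z *\<^sub>C x)"

definition J_tilde :: "('h::separable_chilbert_space \<Rightarrow> 'h) \<Rightarrow> 'h L2 \<Rightarrow> 'h L2" where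
  "J_tilde J = pointwise_op (\<lambda>_. J)"

lemma borel_measurable_pointwise:
  fixes f :: "'a \<Rightarrow> 'h::separable_chilbert_space" and F :: "'a \<Rightarrow> 'h \<Rightarrow> 'h"
  assumes f: "f \<in> borel_measurable M"
    and F: "\<And>x. (\<lambda>z. F z x) \<in> borel_measurable M"
    and lin: "\<And>z. z \<in> space M \<Longrightarrow> bounded_linear (F z)"
  shows "(\<lambda>z. F z (f z)) \<in> borel_measurable M"
proof -
  obtain s where s: "\<And>i. simple_function M (s i)"
      "\<And>z. z \<in> space M \<Longrightarrow> (\<lambda>i. s i z) \<longlonglongrightarrow> f z"
    using borel_measurable_implies_sequence_metric[OF f, of 0] by blast
  have "(\<lambda>z. F z (s i z)) \<in> borel_measurable M" for i
  proof (rule measurable_compose_countable'[where f = "\<lambda>x z. F z x" and I = "s i ` space M"])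
    show "(\<lambda>z. F z x) \<in> borel_measurable M" for x by (rule F)
    show "s i \<in> M \<rightarrow>\<^sub>M count_space (s i ` space M)"
      using s(1)[of i] by (subst measurable_count_space_eq2) (auto simp: simple_function_def)
    show "countable (s i ` space M)"
      using s(1)[of i] by (auto simp: simple_function_def intro: countable_finite)
  qed
  moreover have "(\<lambda>i. F z (s i z)) \<longlonglongrightarrow> F z (f z)" if "z \<in> space M" for z
    using that by (intro bounded_linear.tendsto[OF lin] s(2))
  ultimately show ?thesis by (rule borel_measurable_LIMSEQ_metric)
qed

lemma rep_pointwise_op:
  fixes F :: "complex \<Rightarrow> 'h::separable_chilbert_space \<Rightarrow> 'h"
  assumes "Linf_L F \<or> Linf_LA F"
  shows "AE z in circle_measure. rep_L2 (pointwise_op F f) z = F z (rep_L2 f z)"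
proof -
  have lin: "bounded_linear (F z)" if "z \<in> space circle_measure" for z
    using assms
  proof
    assume "Linf_L F"
    with that show ?thesis by (simp add: Linf_L_def bounded_clinear_def)
  next
    assume "Linf_LA F"
    with that have "bounded_antilinear (F z)" by (simp add: Linf_LA_def)
    then show ?thesis by (rule bounded_antilinear_imp_bounded_linear)
  qed
  have F: "(\<lambda>z. F z x) \<in> borel_measurable circle_measure" for x
    using assms unfolding Linf_L_def Linf_LA_def by blast
  have "\<exists>K. AE z in circle_measure. onorm (F z) \<le> K"
    using assms unfolding Linf_L_def Linf_LA_def by blast
  then obtain K where K: "AE z in circle_measure. onorm (F z) \<le> K" by blast
  have "square_integrable (\<lambda>z. F z (rep_L2 f z))"
  proof (rule square_integrable_bound[OF _ square_integrable_rep_L2[of f]])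
    show "(\<lambda>z. F z (rep_L2 f z)) \<in> borel_measurable circle_measure"
      by (rule borel_measurable_pointwise[OF square_integrable_measurable[OF square_integrable_rep_L2] F lin])
    show "AE z in circle_measure. norm (F z (rep_L2 f z)) \<le> K * norm (rep_L2 f z)"
      using K AE_space
    proof eventually_elim
      case (elim z)
      have "norm (F z (rep_L2 f z)) \<le> onorm (F z) * norm (rep_L2 f z)"
        by (rule onorm[OF lin[OF elim(2)]])
      also have "\<dots> \<le> K * norm (rep_L2 f z)" by (rule mult_right_mono[OF elim(1)]) simp
      finally show ?case .
    qed
  qed
  then show ?thesis unfolding pointwise_op_def by (rule rep_abs_L2)
qed

end

theory Submission
  imports Defs
begin

text \<open>The heart of the matter is that a conjugation \<open>C\<close> with \<open>M_z C = C M_cnj_z\<close> is a pointwise isometry: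
  \<open>|(C f)(z)| = |f(z)|\<close> for almost all \<open>z\<close>. Conjugating the relation by \<open>C\<close> gives
  \<open>C M_z = M_cnj_z C\<close> as well, so \<open>C\<close> commutes with multiplication by every real polynomial \<open>p\<close> in the
  coordinates of \<open>z\<close> (\<open>intertwining_extends_to_polynomials\<close>). As \<open>C\<close> reverses inner products,
  \<open>\<integral> p |C f|\<^sup>2 = \<langle>C (p f), C f\<rangle> = \<langle>f, p f\<rangle> = \<integral> p |f|\<^sup>2\<close>, and by the Stone-Weierstrass theorem the
  integrable function \<open>|C f|\<^sup>2 - |f|\<^sup>2\<close>, being orthogonal to all polynomials, vanishes almost
  everywhere (\<open>conjugation_norm_AE\<close>).

  The values \<open>C0(z) x = (C x)(z)\<close> on constant functions then determine \<open>C\<close>. Choose a countable dense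
  set \<open>D\<close> of vectors and a countable dense set \<open>Q\<close> of scalars. Applied to \<open>q x + r y - w\<close>, the pointwise
  isometry holds off one null set for all \<open>x, y, w\<close> in \<open>D\<close> and \<open>q, r\<close> in \<open>Q\<close> simultaneously. This single
  relation compares sums and multiples only through distances to points of \<open>D\<close>, so it makes sense on
  a bare dense set, and it already says that \<open>C0(z)\<close> extends to an antilinear isometry of the whole
  space (\<open>antilinear_isometry_extension\<close>). The pointwise isometry for \<open>f - x\<close>, with \<open>x\<close> in \<open>D\<close>
  tending to \<open>f(z)\<close>, shows \<open>(C f)(z) = C0(z) f(z)\<close>, and \<open>C (C x) = x\<close> makes \<open>C0(z)\<close> an involution. Conversely, pointwise
  conjugations integrate to a conjugation with the intertwining relation.

  The third condition is the second one with \<open>C0(z) = J U(z)\<close>: a product of two conjugations is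
  unitary and symmetric with respect to both. To return from the third condition, at least one \<open>J\<close> must
  exist. It is obtained from a maximal set \<open>S\<close> on which the inner product is real, for which the
  space splits as \<open>S + \<i> S\<close> (\<open>conjugation_exists\<close>).\<close>

section \<open>Complex scalar multiplication\<close>

lemma scaleC_diff_right: "a *\<^sub>C (x - y) = a *\<^sub>C x - a *\<^sub>C (y :: 'a::complex_inner)"
  by (rule linear_diff[OF bounded_linear.linear[OF bounded_linear_scaleC]])

lemma scaleC_minus_one [simp]: "(- 1) *\<^sub>C (x :: 'a::complex_inner) = - x"
  using scaleC_of_real[of "-1" x] by simp

lemma scaleC_zero_right [simp]: "a *\<^sub>C (0 :: 'a::complex_inner) = 0"
  by (rule linear_0[OF bounded_linear.linear[OF bounded_linear_scaleC]])

lemma bounded_bilinear_scaleC: "bounded_bilinear (\<lambda>a (x :: 'a::complex_inner). a *\<^sub>C x)"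
proof
  show "(a + b) *\<^sub>C x = a *\<^sub>C x + b *\<^sub>C x" for a b and x :: 'a by (rule scaleC_add_left)
  show "a *\<^sub>C (x + y) = a *\<^sub>C x + a *\<^sub>C y" for a and x y :: 'a by (rule scaleC_add_right)
  show "(r *\<^sub>R a) *\<^sub>C x = r *\<^sub>R (a *\<^sub>C x)" for r a and x :: 'a
    by (simp add: scaleC_of_real[symmetric] scaleC_scaleC scaleR_conv_of_real)
  show "a *\<^sub>C (r *\<^sub>R x) = r *\<^sub>R (a *\<^sub>C x)" for r a and x :: 'a
    by (simp add: scaleC_of_real[symmetric] scaleC_scaleC mult.commute)
  show "\<exists>K. \<forall>a (x :: 'a). norm (a *\<^sub>C x) \<le> norm a * norm x * K"
    by (rule exI[of _ 1]) simp
qed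

lemmas continuous_on_scaleC = bounded_bilinear.continuous_on[OF bounded_bilinear_scaleC]

lemma cadjoint_eqI:
  assumes "\<And>x y. cinner (A x) y = cinner x (B y)"
  shows "cadjoint A = B"
  unfolding cadjoint_def
proof (rule the_equality)
  show "\<forall>x y. cinner (A x) y = cinner x (B y)" using assms by blast
next
  fix B' assume "\<forall>x y. cinner (A x) y = cinner x (B' y)"
  then show "B' = B" using assms by (intro ext cinner_ext) metis
qed

section \<open>Existence of conjugations\<close>

text \<open>A minimizing sequence for the distance converges by completeness, and its limit is the foot of the
  perpendicular because moving along any \<open>s\<close> in \<open>S\<close> cannot decrease the distance.\<close>

lemma orthogonal_projection_exists:
  fixes S :: "'a::{real_inner, complete_space} set"
  assumes "subspace S" and "closed S"
  obtains p where "p \<in> S" "\<And>s. s \<in> S \<Longrightarrow> inner (h - p) s = 0"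
proof -
  define d where "d = (INF s\<in>S. (norm (h - s))\<^sup>2)"
  have S0: "S \<noteq> {}" using subspace_0[OF assms(1)] by blast
  have bdd: "bdd_below ((\<lambda>s. (norm (h - s))\<^sup>2) ` S)" by (rule bdd_belowI[of _ 0]) auto
  have d_le: "d \<le> (norm (h - s))\<^sup>2" if "s \<in> S" for s
    unfolding d_def by (rule cINF_lower[OF bdd that])
  have "\<exists>s\<in>S. (norm (h - s))\<^sup>2 < d + 1 / real (Suc n)" for n
    using cINF_less_iff[OF S0 bdd, of "d + 1 / real (Suc n)"] by (simp add: d_def)
  then obtain X where X: "\<And>n. X n \<in> S" "\<And>n. (norm (h - X n))\<^sup>2 < d + 1 / real (Suc n)"
    by metis
  \<comment> \<open>The parallelogram law at the midpoint of \<open>x\<close> and \<open>y\<close>: a minimizing sequence is Cauchy.\<close>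
  have par: "(norm (x - y))\<^sup>2 \<le> 2 * (((norm (h - x))\<^sup>2 - d) + ((norm (h - y))\<^sup>2 - d))"
    if "x \<in> S" "y \<in> S" for x y
  proof -
    have "(1/2) *\<^sub>R (x + y) \<in> S" using assms(1) that by (simp add: subspace_add subspace_scale)
    then have "d \<le> (norm (h - (1/2) *\<^sub>R (x + y)))\<^sup>2" by (rule d_le)
    then show ?thesis
      by (simp add: power2_norm_eq_inner inner_add_left inner_add_right inner_diff_left
          inner_diff_right inner_commute field_simps)
  qed
  have "Cauchy X"
  proof (rule metric_CauchyI)
    fix e :: real assume e: "0 < e"
    then obtain N where N: "1 / real (Suc N) < e\<^sup>2 / 4" using nat_approx_posE[of "e\<^sup>2/4"] by auto
    have *: "(norm (h - X n))\<^sup>2 - d < e\<^sup>2 / 4" if "n \<ge> N" for n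
    proof -
      have "1 / real (Suc n) \<le> 1 / real (Suc N)" using that by (simp add: frac_le)
      then show ?thesis using X(2)[of n] N by linarith
    qed
    have "dist (X i) (X j) < e" if "i \<ge> N" "j \<ge> N" for i j
    proof -
      have "(norm (X i - X j))\<^sup>2 < e\<^sup>2"
        using par[OF X(1) X(1), of i j] *[OF that(1)] *[OF that(2)] by (simp add: field_simps)
      then show ?thesis using e unfolding dist_norm by (intro power2_less_imp_less[of _ e]) auto
    qed
    then show "\<exists>M. \<forall>m\<ge>M. \<forall>n\<ge>M. dist (X m) (X n) < e" by blast
  qed
  then obtain p where p: "X \<longlonglongrightarrow> p" using Cauchy_convergent convergent_def by blast
  have pS: "p \<in> S" by (rule closed_sequentially[OF assms(2) X(1) p])
  have "(\<lambda>n. (norm (h - X n))\<^sup>2) \<longlonglongrightarrow> (norm (h - p))\<^sup>2" by (intro tendsto_intros p)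
  moreover have "(\<lambda>n. d + 1 / real (Suc n)) \<longlonglongrightarrow> d + 0"
    by (intro tendsto_intros LIMSEQ_Suc[OF lim_1_over_n])
  ultimately have "(norm (h - p))\<^sup>2 \<le> d + 0"
    by (rule LIMSEQ_le) (use X(2) in \<open>auto intro: less_imp_le\<close>)
  then have pmin: "(norm (h - p))\<^sup>2 \<le> (norm (h - s))\<^sup>2" if "s \<in> S" for s
    using d_le[OF that] by linarith
  have "inner (h - p) s = 0" if s: "s \<in> S" for s
  proof (rule ccontr)
    assume nz: "inner (h - p) s \<noteq> 0"
    then have s0: "inner s s > 0" by auto
    \<comment> \<open>The step that minimizes \<open>norm (h - p - t s)\<close> over \<open>t\<close>.\<close>
    define t where "t = inner (h - p) s / inner s s"
    have "p + t *\<^sub>R s \<in> S" using assms(1) pS s by (simp add: subspace_add subspace_scale)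
    from pmin[OF this] have "inner (h - p) (h - p) \<le> inner (h - p - t *\<^sub>R s) (h - p - t *\<^sub>R s)"
      by (simp add: power2_norm_eq_inner diff_diff_eq)
    also have "\<dots> = inner (h - p) (h - p) + (t\<^sup>2 * inner s s - 2 * t * inner (h - p) s)"
      unfolding inner_diff_left[of "h - p"] inner_diff_right[of _ "h - p"] inner_commute[of s "h - p"]
      by (simp add: power2_eq_square inner_commute)
    finally have "0 \<le> t\<^sup>2 * inner s s - 2 * t * inner (h - p) s" by simp
    also have "\<dots> = - ((inner (h - p) s)\<^sup>2 / inner s s)"
      using s0 by (simp add: t_def power2_eq_square field_simps)
    finally show False using nz s0 by (simp add: divide_le_0_iff)
  qed
  with pS show thesis by (rule that)
qed

text \<open>The real subspace \<open>S\<close> of vectors fixed by a conjugation is a maximal set on which the inner product is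
  real. Conversely, Zorn's lemma provides such a set, and projection onto it produces the conjugation.\<close>

lemma conjugation_exists: "\<exists>J :: 'a::chilbert_space \<Rightarrow> 'a. conjugation J"
proof -
  define F where "F = {S :: 'a set. \<forall>x\<in>S. \<forall>y\<in>S. Im (cinner x y) = 0}"
  have im_sym: "Im (cinner x y) = 0 \<longleftrightarrow> Im (cinner y x) = 0" for x y :: 'a
    by (subst cinner_commute) simp
  have "\<exists>S\<in>F. \<forall>X\<in>F. S \<subseteq> X \<longrightarrow> X = S"
  proof (rule subset_Zorn)
    fix c assume c: "subset.chain F c"
    have "\<Union>c \<in> F"
      unfolding F_def
    proof (intro CollectI ballI)
      fix x y assume "x \<in> \<Union>c" "y \<in> \<Union>c"
      then obtain X Y where XY: "X \<in> c" "Y \<in> c" "x \<in> X" "y \<in> Y" by blast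
      with c have "X \<subseteq> Y \<or> Y \<subseteq> X" and "X \<in> F" "Y \<in> F"
        unfolding subset_chain_def by blast+
      with XY show "Im (cinner x y) = 0" unfolding F_def by blast
    qed
    then show "\<exists>U\<in>F. \<forall>X\<in>c. X \<subseteq> U" by blast
  qed
  then obtain S where SF: "S \<in> F" and max: "\<And>X. X \<in> F \<Longrightarrow> S \<subseteq> X \<Longrightarrow> X = S" by blast
  \<comment> \<open>Maximality makes \<open>S\<close> the real orthogonal complement of \<open>\<i> S\<close>: a vector whose inner products
    with \<open>S\<close> are all real can be adjoined, since its inner product with itself is real anyway.\<close>
  have S_iff: "x \<in> S \<longleftrightarrow> (\<forall>s\<in>S. inner x (\<i> *\<^sub>C s) = 0)" for x
  proof
    assume "x \<in> S"
    then show "\<forall>s\<in>S. inner x (\<i> *\<^sub>C s) = 0"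
      using SF by (simp add: F_def cinner_conv_inner)
  next
    assume "\<forall>s\<in>S. inner x (\<i> *\<^sub>C s) = 0"
    then have r: "\<forall>s\<in>S. Im (cinner x s) = 0" by (simp add: cinner_conv_inner)
    moreover have "Im (cinner x x) = 0" using arg_cong[OF cinner_commute[of x x], of Im] by simp
    moreover have "\<forall>s\<in>S. Im (cinner s x) = 0" using r im_sym by blast
    ultimately have "insert x S \<in> F" using SF by (auto simp: F_def)
    then show "x \<in> S" using max[of "insert x S"] by blast
  qed
  have S_eq: "S = (\<Inter>s\<in>S. {x. inner x (\<i> *\<^sub>C s) = 0})" using S_iff by blast
  have ort: "inner x (\<i> *\<^sub>C s) = 0" if "x \<in> S" "s \<in> S" for x s
    using S_iff that by blast
  have sub: "subspace S"
    by (rule subspaceI; subst S_iff) (simp_all add: inner_add_left ort)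
  have "closed (\<Inter>s\<in>S. {x. inner x (\<i> *\<^sub>C s) = 0})"
    by (intro closed_INT ballI closed_Collect_eq continuous_intros)
  then have clo: "closed S" using S_eq by simp
  \<comment> \<open>If \<open>h - p\<close> is real orthogonal to \<open>S\<close>, then \<open>\<i> (h - p)\<close> is real orthogonal to \<open>\<i> S\<close>, so it lies
    in \<open>S\<close>. Hence the whole space is \<open>S + \<i> S\<close>.\<close>
  have "\<exists>p. p \<in> S \<and> \<i> *\<^sub>C (h - p) \<in> S" for h
  proof -
    obtain p where p: "p \<in> S" "\<And>s. s \<in> S \<Longrightarrow> inner (h - p) s = 0"
      using orthogonal_projection_exists[OF sub clo] by blast
    have "inner (\<i> *\<^sub>C (h - p)) (\<i> *\<^sub>C s) = inner (h - p) s" for s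
      unfolding Re_cinner[symmetric] by (simp add: cinner_scaleC_left cinner_scaleC_right)
    with p(2) have "\<i> *\<^sub>C (h - p) \<in> S" unfolding S_iff[of "\<i> *\<^sub>C _"] by simp
    with p(1) show ?thesis by blast
  qed
  then obtain P where P: "\<And>h. P h \<in> S" "\<And>h. \<i> *\<^sub>C (h - P h) \<in> S" by metis
  \<comment> \<open>The sum is direct, as \<open>S\<close> is orthogonal to \<open>\<i> S\<close>; all properties of \<open>P\<close> follow from uniqueness.\<close>
  have uniq: "P h = p" if "p \<in> S" "\<i> *\<^sub>C (h - p) \<in> S" for h p
  proof -
    let ?d = "P h - p"
    have d: "?d \<in> S" using sub P(1) that(1) by (simp add: subspace_diff)
    have "\<i> *\<^sub>C (h - p) - \<i> *\<^sub>C (h - P h) \<in> S" using sub P(2) that(2) by (simp add: subspace_diff)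
    then have "\<i> *\<^sub>C ?d \<in> S" by (simp add: scaleC_diff_right)
    with d have "inner (\<i> *\<^sub>C ?d) (\<i> *\<^sub>C ?d) = 0" using S_iff by blast
    then have "norm (\<i> *\<^sub>C ?d) = 0" by simp
    then show ?thesis unfolding norm_scaleC by simp
  qed
  have P_add: "P (g + h) = P g + P h" for g h
  proof (rule uniq)
    show "P g + P h \<in> S" using sub P(1) by (simp add: subspace_add)
    have "\<i> *\<^sub>C (g - P g) + \<i> *\<^sub>C (h - P h) \<in> S" using sub P(2) by (simp add: subspace_add)
    also have "\<i> *\<^sub>C (g - P g) + \<i> *\<^sub>C (h - P h) = \<i> *\<^sub>C (g + h - (P g + P h))"
      by (simp add: scaleC_diff_right scaleC_add_right)
    finally show "\<i> *\<^sub>C (g + h - (P g + P h)) \<in> S" .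
  qed
  have P_R: "P (r *\<^sub>R h) = r *\<^sub>R P h" for r h
  proof (rule uniq)
    show "r *\<^sub>R P h \<in> S" using sub P(1) by (simp add: subspace_scale)
    have "r *\<^sub>R (\<i> *\<^sub>C (h - P h)) \<in> S" using sub P(2) by (simp add: subspace_scale)
    also have "r *\<^sub>R (\<i> *\<^sub>C (h - P h)) = \<i> *\<^sub>C (r *\<^sub>R h - r *\<^sub>R P h)"
      by (simp add: scaleC_of_real[symmetric] scaleC_scaleC scaleC_diff_right mult.commute)
    finally show "\<i> *\<^sub>C (r *\<^sub>R h - r *\<^sub>R P h) \<in> S" .
  qed
  have P_i: "P (\<i> *\<^sub>C h) = \<i> *\<^sub>C (h - P h)" for h
  proof (rule uniq)
    show "\<i> *\<^sub>C (h - P h) \<in> S" by (rule P)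
    have "\<i> *\<^sub>C (\<i> *\<^sub>C h - \<i> *\<^sub>C (h - P h)) = - P h"
      by (simp add: scaleC_diff_right scaleC_scaleC)
    then show "\<i> *\<^sub>C (\<i> *\<^sub>C h - \<i> *\<^sub>C (h - P h)) \<in> S"
      using subspace_neg[OF sub P(1)] by simp
  qed
  have P_P: "P (P h) = P h" for h
    by (rule uniq) (use P(1) subspace_0[OF sub] in auto)
  \<comment> \<open>The conjugation with real part \<open>S\<close>: the identity on \<open>S\<close> and minus the identity on \<open>\<i> S\<close>.\<close>
  define J where "J h = P h - (h - P h)" for h
  have J_add: "J (g + h) = J g + J h" for g h by (simp add: J_def P_add)
  have J_R: "J (r *\<^sub>R h) = r *\<^sub>R J h" for r h by (simp add: J_def P_R scaleR_diff_right)
  have J_i: "J (\<i> *\<^sub>C h) = (- \<i>) *\<^sub>C J h" for h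
  proof -
    have m: "(- \<i>) *\<^sub>C x = - (\<i> *\<^sub>C x)" for x :: 'a
      using scaleC_scaleC[of "-1" \<i> x] by simp
    show ?thesis by (simp add: J_def P_i scaleC_diff_right m)
  qed
  have J_C: "J (a *\<^sub>C h) = cnj a *\<^sub>C J h" for a h
  proof -
    have dec: "b *\<^sub>C x = Re b *\<^sub>R x + Im b *\<^sub>R (\<i> *\<^sub>C x)" for b and x :: 'a
      unfolding scaleC_of_real[symmetric] scaleC_scaleC scaleC_add_left[symmetric]
      by (rule arg_cong[where f = "\<lambda>b. b *\<^sub>C x"]) (simp add: complex_eq_iff)
    have "J (a *\<^sub>C h) = Re a *\<^sub>R J h + Im a *\<^sub>R ((- \<i>) *\<^sub>C J h)"
      by (subst dec) (simp only: J_add J_R J_i)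
    also have "\<dots> = cnj a *\<^sub>C J h"
      unfolding scaleC_of_real[symmetric] scaleC_scaleC scaleC_add_left[symmetric]
      by (rule arg_cong[where f = "\<lambda>b. b *\<^sub>C J h"]) (simp add: complex_eq_iff)
    finally show ?thesis .
  qed
  have P_diff: "P (g - h) = P g - P h" for g h
    using P_add[of g "(-1) *\<^sub>R h"] P_R[of "-1" h] by simp
  have J_J: "J (J h) = h" for h by (simp add: J_def P_diff P_P)
  have "Im (cinner (P f) (P g)) = 0" for f g using SF P(1) by (simp add: F_def)
  moreover have "Im (cinner (f - P f) (g - P g)) = 0" for f g
  proof -
    have "Im (cinner (\<i> *\<^sub>C (f - P f)) (\<i> *\<^sub>C (g - P g))) = 0" using SF P(2) by (simp add: F_def)
    then show ?thesis by (simp add: cinner_scaleC_left cinner_scaleC_right)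
  qed
  moreover have "Re (cinner (P f) (g - P g)) = 0" for f g
  proof -
    have "Im (cinner (P f) (\<i> *\<^sub>C (g - P g))) = 0" using SF P by (simp add: F_def)
    then show ?thesis by (simp add: cinner_scaleC_right)
  qed
  moreover have "Re (cinner (f - P f) (P g)) = 0" for f g
    using calculation(3)[of g f] by (subst cinner_commute) simp
  ultimately have parts: "cnj (cinner (P f) (P g)) = cinner (P f) (P g)"
    "cnj (cinner (f - P f) (g - P g)) = cinner (f - P f) (g - P g)"
    "cnj (cinner (P f) (g - P g)) = - cinner (P f) (g - P g)"
    "cnj (cinner (f - P f) (P g)) = - cinner (f - P f) (P g)" for f g
    by (simp_all add: complex_eq_iff)
  have add_r: "cinner x (y + z) = cinner x y + cinner x z" for x y z :: 'a
    by (metis cinner_commute cinner_add_left complex_cnj_add)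
  have min_l: "cinner (- x) y = - cinner x y" and min_r: "cinner x (- y) = - cinner x y" for x y :: 'a
    using cinner_scaleC_left[of "-1" x y] cinner_scaleC_right[of x "-1" y] by simp_all
  have J_inner: "cinner (J f) (J g) = cinner g f" for f g
  proof -
    let ?a = "P f" and ?b = "f - P f" and ?c = "P g" and ?d = "g - P g"
    have "cinner (J f) (J g) = cinner (?a + - ?b) (?c + - ?d)"
      by (simp only: J_def add_uminus_conv_diff)
    also have "\<dots> = cinner ?a ?c - cinner ?a ?d - cinner ?b ?c + cinner ?b ?d"
      unfolding cinner_add_left add_r min_l min_r by simp
    also have "\<dots> = cnj (cinner (?a + ?b) (?c + ?d))"
      unfolding cinner_add_left add_r complex_cnj_add parts by simp
    also have "\<dots> = cinner g f" using cinner_commute[of g f] by simp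
    finally show ?thesis .
  qed
  have "conjugation J"
    unfolding conjugation_def antilinear_def using J_add J_C J_J J_inner by (auto simp: fun_eq_iff)
  then show ?thesis by blast
qed

section \<open>Antilinear isometries\<close>

text \<open>By polarization a norm-preserving antilinear map preserves the real inner product; antilinearity
  turns this into a reversal of the complex one.\<close>

lemma antilinear_isometry_conjugation:
  fixes T :: "'a::complex_inner \<Rightarrow> 'a"
  assumes T: "antilinear T" and iso: "\<And>x. norm (T x) = norm x" and inv: "\<And>x. T (T x) = x"
  shows "conjugation T"
proof -
  have add: "T (x + y) = T x + T y" and sc: "T (a *\<^sub>C x) = cnj a *\<^sub>C T x" for a x y
    using T by (auto simp: antilinear_def)
  have inner_T: "inner (T x) (T y) = inner x y" for x y
  proof -
    have "inner (T x) (T y) = ((norm (T x + T y))\<^sup>2 - (norm (T x))\<^sup>2 - (norm (T y))\<^sup>2) / 2"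
      by (rule dot_norm)
    also have "\<dots> = ((norm (x + y))\<^sup>2 - (norm x)\<^sup>2 - (norm y)\<^sup>2) / 2"
      unfolding add[symmetric] iso ..
    finally show ?thesis by (simp add: dot_norm)
  qed
  have "cinner (T x) (T y) = cinner y x" for x y
  proof -
    have "\<i> *\<^sub>C T y = T ((- \<i>) *\<^sub>C y)" by (simp add: sc)
    also have "(- \<i>) *\<^sub>C y = - (\<i> *\<^sub>C y)" using scaleC_scaleC[of "-1" \<i> y] by simp
    finally have "inner (T x) (\<i> *\<^sub>C T y) = - inner x (\<i> *\<^sub>C y)" by (simp add: inner_T)
    then have "cinner (T x) (T y) = cnj (cinner x y)"
      by (simp add: cinner_conv_inner inner_T complex_eq_iff)
    then show ?thesis using cinner_commute[of y x] by simp
  qed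
  then show ?thesis using T inv by (auto simp: conjugation_def fun_eq_iff)
qed

text \<open>The relation with five parameters encodes the isometry property (\<open>q = 1\<close>, \<open>r = 0\<close>), additivity
  (\<open>w\<close> near \<open>x + y\<close>) and conjugate homogeneity (\<open>w\<close> near \<open>q x\<close>) at once, and it makes sense on dense
  sets that have no algebraic structure.\<close>

lemma antilinear_isometry_extension:
  fixes T :: "'a::chilbert_space \<Rightarrow> 'a"
  assumes Q: "closure Q = UNIV" "0 \<in> Q" "1 \<in> Q" and D: "closure D = UNIV"
    and T: "\<And>q r x y w. \<lbrakk>q \<in> Q; r \<in> Q; x \<in> D; y \<in> D; w \<in> D\<rbrakk> \<Longrightarrow>
      norm (cnj q *\<^sub>C T x + cnj r *\<^sub>C T y - T w) = norm (q *\<^sub>C x + r *\<^sub>C y - w)"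
  shows "\<exists>T'. antilinear T' \<and> (\<forall>x. norm (T' x) = norm x) \<and> (\<forall>x\<in>D. T' x = T x)"
proof -
  have zero: "0 *\<^sub>C x = 0" for x :: 'a using scaleC_of_real[of 0 x] by simp
  have "dist (T x) (T w) = dist x w" if "x \<in> D" "w \<in> D" for x w
    using T[of 1 0 x x w] Q that by (simp add: dist_norm zero)
  then have "uniformly_continuous_on D T" unfolding uniformly_continuous_on_def by auto
  then obtain T' where uc: "uniformly_continuous_on (closure D) T'" and T': "\<And>x. x \<in> D \<Longrightarrow> T x = T' x"
    by (rule uniformly_continuous_on_extension_on_closure[of D T]) blast
  have cT: "continuous_on UNIV T'" using uniformly_continuous_imp_continuous[OF uc] D by simp
  \<comment> \<open>The relation extends from the dense set to all arguments, as both sides are continuous.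
    Each wanted property is then an instance that makes the right-hand norm trivial.\<close>
  define F where "F = (\<lambda>(q, r, x, y, w). norm (cnj q *\<^sub>C T' x + cnj r *\<^sub>C T' y - T' w)
      - norm (q *\<^sub>C x + r *\<^sub>C y - w))"
  have cT': "continuous_on UNIV (\<lambda>u. T' (g u))" if "continuous_on UNIV g" for g :: "complex \<times> complex \<times> 'a \<times> 'a \<times> 'a \<Rightarrow> 'a"
    by (rule continuous_on_compose2[OF cT that]) simp
  have "continuous_on UNIV F"
    unfolding F_def case_prod_unfold
    by (intro continuous_intros continuous_on_scaleC cT')
  then have "F u = 0" for u
    by (intro continuous_constant_on_closure[of "Q \<times> Q \<times> D \<times> D \<times> D" F 0 u])
      (auto simp: closure_Times Q D F_def T'[symmetric] T)
  then have all: "norm (cnj q *\<^sub>C T' x + cnj r *\<^sub>C T' y - T' w) = norm (q *\<^sub>C x + r *\<^sub>C y - w)" for q r x y w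
    by (simp add: F_def split_paired_all)
  have "T' 0 = 0" using all[of 0 0 0 0 0] by (simp add: zero)
  then have "norm (T' x) = norm x" for x using all[of 1 x 0 0 0] by (simp add: zero)
  moreover have "T' (x + y) = T' x + T' y" for x y using all[of 1 x 1 y "x + y"] by simp
  moreover have "T' (a *\<^sub>C x) = cnj a *\<^sub>C T' x" for a x using all[of a x 0 x "a *\<^sub>C x"] by (simp add: zero)
  ultimately show ?thesis using T' by (auto simp: antilinear_def intro!: exI[of _ T'])
qed

section \<open>Integrable functions orthogonal to all polynomials\<close>

text \<open>The vanishing of the integrals spreads from polynomials to continuous functions by uniform
  approximation, to indicators of closed sets by dominated convergence, and to all measurable sets
  because the closed sets are an intersection-stable generator of the Borel sets.\<close>

lemma AE_eq_0_if_orthogonal_to_polynomials: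
  fixes G :: "'a::euclidean_space \<Rightarrow> real"
  assumes sets_M: "sets M = sets (restrict_space borel K)" and K: "compact K"
    and sf: "sigma_finite_measure M" and G: "integrable M G"
    and poly: "\<And>p. real_polynomial_function p \<Longrightarrow> (LINT z|M. p z * G z) = 0"
  shows "AE z in M. G z = 0"
proof -
  have space_M: "space M = K" using sets_eq_imp_space_eq[OF sets_M] by (simp add: space_restrict_space)
  note [measurable] = G[THEN borel_measurable_integrable]
  have meas: "p \<in> borel_measurable M" if "continuous_on UNIV p" for p :: "'a \<Rightarrow> real"
    using borel_measurable_continuous_onI[OF that] sets_M
    by (simp add: measurable_restrict_space1 cong: measurable_cong_sets)
  have int: "integrable M (\<lambda>z. p z * G z)" if "continuous_on UNIV p" for p
  proof -
    have "compact (p ` K)" by (rule compact_continuous_image[OF continuous_on_subset[OF that] K]) simp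
    then obtain B where B: "\<And>z. z \<in> K \<Longrightarrow> \<bar>p z\<bar> \<le> B"
      using compact_imp_bounded bounded_iff by (metis image_eqI real_norm_def)
    show ?thesis
    proof (rule Bochner_Integration.integrable_bound[of M "\<lambda>z. B * G z"])
      show "integrable M (\<lambda>z. B * G z)" using G by simp
      show "(\<lambda>z. p z * G z) \<in> borel_measurable M" using meas[OF that] by measurable
      show "AE z in M. norm (p z * G z) \<le> norm (B * G z)"
        using AE_space
      proof eventually_elim
        case (elim z)
        have "\<bar>p z\<bar> \<le> \<bar>B\<bar>" using B[of z] elim space_M by force
        then show ?case by (simp add: abs_mult mult_right_mono)
      qed
    qed
  qed
  \<comment> \<open>Uniform approximation on \<open>K\<close> passes from polynomials to continuous functions.\<close>
  have cont0: "(LINT z|M. p z * G z) = 0" if p: "continuous_on UNIV p" for p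
  proof -
    have "\<bar>LINT z|M. p z * G z\<bar> \<le> e * (LINT z|M. \<bar>G z\<bar>)" if e: "e > 0" for e
    proof -
      obtain q where q: "real_polynomial_function q" "\<And>z. z \<in> K \<Longrightarrow> \<bar>p z - q z\<bar> < e"
        using Stone_Weierstrass_real_polynomial_function[OF K continuous_on_subset[OF p] e] by auto
      have qc: "continuous_on UNIV q"
        using q(1) by (simp add: continuous_on_polymonial_function real_polynomial_function_eq)
      have "(LINT z|M. p z * G z) = (LINT z|M. p z * G z) - (LINT z|M. q z * G z)"
        using poly[OF q(1)] by simp
      also have "\<dots> = (LINT z|M. p z * G z - q z * G z)"
        by (rule Bochner_Integration.integral_diff[symmetric]) (intro int p qc)+
      also have "\<bar>\<dots>\<bar> \<le> (LINT z|M. e * \<bar>G z\<bar>)"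
      proof (rule integral_abs_bound[THEN order_trans], rule integral_mono_AE)
        show "integrable M (\<lambda>z. \<bar>p z * G z - q z * G z\<bar>)"
          by (intro integrable_abs Bochner_Integration.integrable_diff int p qc)
        show "integrable M (\<lambda>z. e * \<bar>G z\<bar>)" using G by simp
        show "AE z in M. \<bar>p z * G z - q z * G z\<bar> \<le> e * \<bar>G z\<bar>"
          using AE_space
        proof eventually_elim
          case (elim z)
          have "\<bar>p z * G z - q z * G z\<bar> = \<bar>p z - q z\<bar> * \<bar>G z\<bar>"
            by (simp add: abs_mult[symmetric] left_diff_distrib)
          also have "\<dots> \<le> e * \<bar>G z\<bar>" using q(2)[of z] elim space_M by (intro mult_right_mono) auto
          finally show ?case .
        qed
      qed
      finally show ?thesis by simp
    qed
    note le = this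
    have "\<bar>LINT z|M. p z * G z\<bar> \<le> 0"
    proof (rule field_le_epsilon)
      fix e :: real assume e: "e > 0"
      let ?N = "LINT z|M. \<bar>G z\<bar>"
      have N: "?N + 1 > 0" by (rule add_nonneg_pos) simp_all
      have "\<bar>LINT z|M. p z * G z\<bar> \<le> e / (?N + 1) * ?N" by (intro le divide_pos_pos e N)
      also have "\<dots> \<le> e" using e N by (simp add: field_simps)
      finally show "\<bar>LINT z|M. p z * G z\<bar> \<le> 0 + e" by simp
    qed
    then show ?thesis by simp
  qed
  have ind_int: "integrable M (\<lambda>z. indicator A z * G z)" if "A \<in> sets borel" for A
  proof -
    have "indicat_real A \<in> borel_measurable borel" using that by simp
    then have "indicat_real A \<in> borel_measurable M"
      using sets_M by (simp add: measurable_restrict_space1 cong: measurable_cong_sets)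
    then show ?thesis
      by (intro Bochner_Integration.integrable_bound[OF G]) (auto split: split_indicator)
  qed
  have closed0: "(LINT z|M. indicator F z * G z) = 0" if F: "closed F" for F
  proof (cases "F = {}")
    case False
    \<comment> \<open>Continuous functions with values in \<open>{0..1}\<close> that decrease to the indicator of \<open>F\<close>.\<close>
    define u where "u n z = max 0 (1 - real n * infdist z F)" for n z
    have uc: "continuous_on UNIV (u n)" for n
      unfolding u_def by (intro continuous_intros)
    have "(\<lambda>n. LINT z|M. u n z * G z) \<longlonglongrightarrow> (LINT z|M. indicator F z * G z)"
    proof (rule integral_dominated_convergence[where w = "\<lambda>z. \<bar>G z\<bar>"])
      show "(\<lambda>z. indicator F z * G z) \<in> borel_measurable M"
        using ind_int F by auto
      show "(\<lambda>z. u n z * G z) \<in> borel_measurable M" for n using int[OF uc] by auto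
      show "integrable M (\<lambda>z. \<bar>G z\<bar>)" using G by simp
      show "AE z in M. (\<lambda>n. u n z * G z) \<longlonglongrightarrow> indicator F z * G z"
      proof (intro AE_I2 tendsto_mult tendsto_const)
        fix z
        show "(\<lambda>n. u n z) \<longlonglongrightarrow> indicator F z"
        proof (cases "z \<in> F")
          case True
          then show ?thesis by (simp add: u_def)
        next
          case nz: False
          then have pos: "infdist z F > 0"
            using F False in_closed_iff_infdist_zero infdist_nonneg by (metis less_eq_real_def)
          obtain N where N: "1 < real N * infdist z F" using reals_Archimedean3[OF pos] by blast
          have "u n z = 0" if "n \<ge> N" for n
          proof -
            have "real N * infdist z F \<le> real n * infdist z F" using that pos by (simp add: mult_right_mono)
            then show ?thesis using N by (simp add: u_def)
          qed
          then have "eventually (\<lambda>n. u n z = 0) sequentially"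
            using eventually_sequentially by blast
          then show ?thesis using nz by (simp add: tendsto_eventually)
        qed
      qed
      show "AE z in M. norm (u n z * G z) \<le> \<bar>G z\<bar>" for n
      proof (rule AE_I2)
        fix z
        have "0 \<le> u n z" "u n z \<le> 1" by (auto simp: u_def infdist_nonneg)
        then show "norm (u n z * G z) \<le> \<bar>G z\<bar>"
          by (simp add: abs_mult mult_left_le_one_le)
      qed
    qed
    then show ?thesis by (simp add: cont0[OF uc] LIMSEQ_const_iff)
  qed simp
  have borel0: "(LINT z|M. indicator A z * G z) = 0" if A: "A \<in> sets borel" for A
  proof -
    have "A \<in> sigma_sets UNIV (Collect closed)" using A by (simp add: borel_eq_closed)
    have Int_stable_closed: "Int_stable (Collect closed :: 'a set set)" by (auto simp: Int_stable_def)
    have "Collect closed \<subseteq> Pow (UNIV :: 'a set)" by simp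
    from Int_stable_closed this \<open>A \<in> sigma_sets UNIV (Collect closed)\<close> show ?thesis
    proof (induction rule: sigma_sets_induct_disjoint)
      case (basic A)
      then show ?case by (simp add: closed0)
    next
      case empty
      show ?case by simp
    next
      case (compl A)
      then have A: "A \<in> sets borel" by (simp add: borel_eq_closed)
      have "(LINT z|M. indicator (UNIV - A) z * G z) = (LINT z|M. G z - indicator A z * G z)"
        by (rule Bochner_Integration.integral_cong) (auto split: split_indicator)
      also have "\<dots> = (LINT z|M. G z) - (LINT z|M. indicator A z * G z)"
        using G ind_int[OF A] by simp
      also have "(LINT z|M. G z) = 0" using cont0[of "\<lambda>_. 1"] by simp
      finally show ?case using compl by simp
    next
      case (union A)
      have A: "A i \<in> sets borel" for i using union(2) by (auto simp: borel_eq_closed)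
      have "(LINT z|M. indicator (\<Union>i. A i) z * G z) = (\<Sum>i. LINT z|M. indicator (A i) z * G z)"
      proof -
        have on_K: "(LINT z|M. indicator B z * G z) = (LINT z:K \<inter> B|M. G z)" for B
          unfolding set_lebesgue_integral_def
          by (rule Bochner_Integration.integral_cong) (auto simp: space_M split: split_indicator)
        have "(LINT z:(\<Union>i. K \<inter> A i)|M. G z) = (\<Sum>i. LINT z:K \<inter> A i|M. G z)"
        proof (rule lebesgue_integral_countable_add)
          show "K \<inter> A i \<in> sets M" for i unfolding sets_M sets_restrict_space using A by auto
          show "(K \<inter> A i) \<inter> (K \<inter> A j) = {}" if "i \<noteq> j" for i j
            using union(1) that by (auto simp: disjoint_family_on_def)
          have "(\<Union>i. K \<inter> A i) \<in> sets M"
            unfolding sets_M sets_restrict_space using A by (auto simp: Int_UN_distrib[symmetric])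
          then show "set_integrable M (\<Union>i. K \<inter> A i) G"
            unfolding set_integrable_def using G by (intro integrable_mult_indicator)
        qed
        then show ?thesis unfolding on_K Int_UN_distrib .
      qed
      then show ?case using union by simp
    qed
  qed
  show ?thesis
  proof (rule sigma_finite_measure.density_zero[OF sf G])
    fix A assume "A \<in> sets M"
    then obtain B where B: "B \<in> sets borel" "A = K \<inter> B" unfolding sets_M sets_restrict_space by auto
    have "set_lebesgue_integral M A G = (LINT z|M. indicator B z * G z)"
      unfolding set_lebesgue_integral_def
      by (rule Bochner_Integration.integral_cong) (auto simp: B space_M split: split_indicator)
    then show "set_lebesgue_integral M A G = 0" using borel0[OF B(1)] by simp
  qed
qed

text \<open>The measure on the circle is complete, so a function can be shown to be measurable by comparing it
  almost everywhere with a representative.\<close>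

lemma borel_measurable_completion_cong_AE:
  assumes f: "f \<in> borel_measurable (completion M)" and eq: "AE z in completion M. f z = g z"
  shows "g \<in> borel_measurable (completion M)"
proof (rule measurableI)
  fix A :: "'b set" assume A: "A \<in> sets borel"
  show "g -` A \<inter> space (completion M) \<in> sets (completion M)"
  proof (rule completion.in_sets_AE)
    show "f -` A \<inter> space (completion M) \<in> sets (completion M)" by (rule measurable_sets[OF f A])
    show "AE z in completion M. z \<in> f -` A \<inter> space (completion M) \<longleftrightarrow>
        z \<in> g -` A \<inter> space (completion M)"
      using eq by eventually_elim auto
  qed simp
qed simp

lemma borel_measurable_circle_cong_AE:
  "\<lbrakk>f \<in> borel_measurable circle_measure; AE z in circle_measure. f z = g z\<rbrakk> \<Longrightarrow>
    g \<in> borel_measurable circle_measure"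
  unfolding circle_measure_def by (rule borel_measurable_completion_cong_AE)

lemma square_integrable_cong_AE:
  assumes f: "square_integrable f" and eq: "AE z in circle_measure. f z = g z"
  shows "square_integrable g"
proof (rule square_integrable_bound[of _ f 1])
  show "g \<in> borel_measurable circle_measure"
    by (rule borel_measurable_circle_cong_AE[OF square_integrable_measurable[OF f] eq])
  show "AE z in circle_measure. norm (g z) \<le> 1 * norm (f z)" using eq by eventually_elim simp
qed (rule f)

lemma AE_circle_eq_0_if_orthogonal_to_polynomials:
  fixes G :: "complex \<Rightarrow> real"
  assumes G: "integrable circle_measure G"
    and poly: "\<And>p. real_polynomial_function p \<Longrightarrow> (LINT z|circle_measure. p z * G z) = 0"
  shows "AE z in circle_measure. G z = 0"
proof -
  define M where "M = distr (uniform_measure lborel {0..<2 * pi}) (restrict_space borel (sphere 0 1)) cis"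
  have circle: "circle_measure = completion M" by (simp add: circle_measure_def M_def)
  have sets_M: "sets M = sets (restrict_space borel (sphere 0 1))" by (simp add: M_def)
  have space_M: "space M = sphere 0 1" by (simp add: M_def space_restrict_space)
  have "sphere 0 1 \<in> sets M" using sets.top[of M] space_M by simp
  then have "emeasure M (space M) = 1"
    using emeasure_circle_measure by (simp add: circle space_M)
  then interpret finite_measure M by (intro finite_measureI) auto
  \<comment> \<open>A version of \<open>G\<close> that is measurable before completion, where the closed sets generate.\<close>
  obtain G' where G': "G' \<in> borel_measurable M" "AE z in M. G z = G' z"
    using completion_ex_borel_measurable_real[OF borel_measurable_integrable[OF G[unfolded circle]]]
    by blast
  have ae: "AE z in circle_measure. G z = G' z" unfolding circle by (rule AE_completion[OF G'(2)])
  have G'c: "G' \<in> borel_measurable circle_measure" unfolding circle by (rule measurable_completion[OF G'(1)])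
  have "integrable circle_measure G'"
    using integrable_cong_AE[OF _ G'c ae] G by auto
  then have int: "integrable M G'" using integrable_completion[OF G'(1)] circle by simp
  have "AE z in M. G' z = 0"
  proof (rule AE_eq_0_if_orthogonal_to_polynomials[OF sets_M _ _ int])
    show "sigma_finite_measure M" ..
    fix p :: "complex \<Rightarrow> real" assume p: "real_polynomial_function p"
    have "p \<in> borel_measurable borel"
      using p by (intro borel_measurable_continuous_onI) (simp add: continuous_on_polymonial_function real_polynomial_function_eq)
    then have pM: "p \<in> borel_measurable M" and pc: "p \<in> borel_measurable circle_measure"
      using sets_M borel_measurable_circle by (auto simp: measurable_restrict_space1 cong: measurable_cong_sets)
    have "(LINT z|M. p z * G' z) = (LINT z|circle_measure. p z * G' z)"
      unfolding circle using pM G'(1) by (intro integral_completion[symmetric]) measurable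
    also have "\<dots> = (LINT z|circle_measure. p z * G z)"
    proof (rule integral_cong_AE)
      show "AE z in circle_measure. p z * G' z = p z * G z" using ae by eventually_elim simp
    qed (use pc G'c G in auto)
    finally show "(LINT z|M. p z * G' z) = 0" using poly[OF p] by simp
  qed simp
  then show ?thesis using ae unfolding circle AE_completion_iff by eventually_elim simp
qed

section \<open>Pointwise operators on square-integrable functions\<close>

abbreviation mult_op :: "(complex \<Rightarrow> complex) \<Rightarrow> 'h::separable_chilbert_space L2 \<Rightarrow> 'h L2" where
  "mult_op c \<equiv> pointwise_op (\<lambda>z x. c z *\<^sub>C x)"

lemma Linf_L_scalar:
  assumes c: "continuous_on (sphere 0 1) c"
  shows "Linf_L (\<lambda>z x. c z *\<^sub>C (x :: 'h::separable_chilbert_space))"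
  unfolding Linf_L_def
proof (intro conjI ballI allI)
  fix z
  show "bounded_clinear (\<lambda>x :: 'h. c z *\<^sub>C x)"
    by (simp add: bounded_clinear_def bounded_linear_scaleC scaleC_scaleC mult.commute)
next
  fix x :: 'h
  have "c \<in> borel_measurable circle_measure"
    unfolding circle_measure_def
    by (rule measurable_completion)
      (simp add: borel_measurable_continuous_on_restrict[OF c] cong: measurable_cong_sets)
  then show "(\<lambda>z. c z *\<^sub>C x) \<in> borel_measurable circle_measure"
    by (rule borel_measurable_continuous_on[rotated])
      (intro continuous_on_scaleC continuous_intros)
next
  have "bounded (c ` sphere 0 1)"
    by (intro compact_imp_bounded compact_continuous_image[OF c]) simp
  then obtain K where K: "\<And>z. z \<in> sphere 0 1 \<Longrightarrow> cmod (c z) \<le> K" unfolding bounded_iff by blast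
  have "onorm (\<lambda>x :: 'h. c z *\<^sub>C x) \<le> K" if "z \<in> sphere 0 1" for z
    by (rule onorm_bound)
      (use K[OF that] order_trans[OF norm_ge_zero K[OF that]] in \<open>auto intro: mult_right_mono\<close>)
  then show "\<exists>K. AE z in circle_measure. onorm (\<lambda>x :: 'h. c z *\<^sub>C x) \<le> K"
    by (intro exI[of _ K] AE_I2) simp
qed

lemma rep_mult_op:
  "continuous_on (sphere 0 1) c \<Longrightarrow> AE z in circle_measure. rep_L2 (mult_op c f) z = c z *\<^sub>C rep_L2 f z"
  by (rule rep_pointwise_op) (simp add: Linf_L_scalar)

lemma M_z_conv_mult_op: "M_z = mult_op (\<lambda>z. z)" and M_cnj_z_conv_mult_op: "M_cnj_z = mult_op cnj"
  by (simp_all add: M_z_def M_cnj_z_def)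

lemma Linf_LA_const:
  fixes J :: "'h::separable_chilbert_space \<Rightarrow> 'h"
  assumes "bounded_antilinear J" shows "Linf_LA (\<lambda>_. J)"
  using assms by (auto simp: Linf_LA_def)

lemma rep_J_tilde:
  "conjugation J \<Longrightarrow> AE z in circle_measure. rep_L2 (J_tilde J f) z = J (rep_L2 f z)"
  unfolding J_tilde_def
  by (rule rep_pointwise_op) (simp add: Linf_LA_const conjugation_imp_bounded_antilinear)

text \<open>This also serves for functions such as \<open>\<lambda>z. cadjoint (U z)\<close> that are controlled only almost
  everywhere: \<open>g\<close> itself supplies the square-integrability that makes \<open>pointwise_op F f\<close> meaningful.\<close>

lemma pointwise_op_eqI:
  assumes eq: "AE z in circle_measure. rep_L2 g z = F z (rep_L2 f z)"
  shows "g = pointwise_op F f"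
proof -
  have "square_integrable (\<lambda>z. F z (rep_L2 f z))"
    by (rule square_integrable_cong_AE[OF square_integrable_rep_L2 eq])
  then have "abs_L2 (rep_L2 g) = pointwise_op F f"
    unfolding pointwise_op_def using eq by (subst abs_L2_eq_iff) auto
  then show ?thesis by simp
qed

lemma measurable_bounded_linear_comp:
  "bounded_linear A \<Longrightarrow> f \<in> borel_measurable M \<Longrightarrow> (\<lambda>z. A (f z)) \<in> borel_measurable M"
  by (rule borel_measurable_continuous_on[OF linear_continuous_on])

lemma square_integrable_const: "square_integrable (\<lambda>_. x)"
proof -
  have "finite_measure circle_measure"
    using emeasure_circle_measure by (intro finite_measureI) simp
  then show ?thesis by (simp add: square_integrable_def finite_measure.integrable_const)
qed

section \<open>Conjugations that intertwine multiplication by z and its adjoint\<close>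

text \<open>The multipliers \<open>c\<close> for which \<open>C\<close> carries multiplication by \<open>c\<close> to multiplication by its complex
  conjugate form an algebra that contains the constants, \<open>z\<close> and \<open>cnj z\<close>. For a real multiplier this is
  commutation with \<open>C\<close>.\<close>

lemma intertwining_extends_to_polynomials:
  fixes C :: "'h::separable_chilbert_space L2 \<Rightarrow> 'h L2"
  assumes anti: "antilinear C" and z: "\<And>f. C (M_z f) = M_cnj_z (C f)" and cz: "\<And>f. C (M_cnj_z f) = M_z (C f)"
    and p: "real_polynomial_function p"
  shows "C (mult_op (\<lambda>z. of_real (p z)) f) = mult_op (\<lambda>z. of_real (p z)) (C f)"
proof -
  \<comment> \<open>Complex coefficients are tracked along, so that the coordinate functions are combinations
    of \<open>z\<close> and \<open>cnj z\<close>; antilinearity conjugates the multiplier.\<close>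
  define Q where "Q c \<longleftrightarrow> continuous_on (sphere 0 1) c \<and> (\<forall>f. C (mult_op c f) = mult_op (\<lambda>z. cnj (c z)) (C f))" for c
  have C_add: "C (f + g) = C f + C g" and C_sc: "C (a *\<^sub>C f) = cnj a *\<^sub>C C f" for a f g
    using anti by (auto simp: antilinear_def)
  have mult_const: "mult_op (\<lambda>_. a) f = a *\<^sub>C f" for a and f :: "'h L2"
    by (simp add: pointwise_op_def scaleC_L2_def)
  have mult_add: "mult_op (\<lambda>z. c z + d z) f = mult_op c f + mult_op d f"
    if "continuous_on (sphere 0 1) c" "continuous_on (sphere 0 1) d" for c d and f :: "'h L2"
  proof (rule L2_eqI)
    show "AE z in circle_measure. rep_L2 (mult_op (\<lambda>z. c z + d z) f) z = rep_L2 (mult_op c f + mult_op d f) z"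
      using rep_mult_op[OF continuous_on_add[OF that], of f] rep_mult_op[OF that(1), of f]
        rep_mult_op[OF that(2), of f] rep_L2_add[of "mult_op c f" "mult_op d f"]
      by eventually_elim (simp add: scaleC_add_left)
  qed
  have mult_mult: "mult_op (\<lambda>z. c z * d z) f = mult_op c (mult_op d f)"
    if "continuous_on (sphere 0 1) c" "continuous_on (sphere 0 1) d" for c d and f :: "'h L2"
  proof (rule L2_eqI)
    show "AE z in circle_measure. rep_L2 (mult_op (\<lambda>z. c z * d z) f) z = rep_L2 (mult_op c (mult_op d f)) z"
      using rep_mult_op[OF continuous_on_mult[OF that], of f] rep_mult_op[OF that(1), of "mult_op d f"]
        rep_mult_op[OF that(2), of f]
      by eventually_elim (simp add: scaleC_scaleC)
  qed
  have Q_const: "Q (\<lambda>_. a)" for a by (simp add: Q_def mult_const C_sc)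
  have Q_add: "Q (\<lambda>z. c z + d z)" if "Q c" "Q d" for c d
    using that by (auto simp: Q_def mult_add C_add intro!: continuous_intros)
  have Q_mult: "Q (\<lambda>z. c z * d z)" if "Q c" "Q d" for c d
    using that by (auto simp: Q_def mult_mult intro!: continuous_intros)
  have Q_z: "Q (\<lambda>z. z)" and Q_cnj: "Q cnj"
    using z cz by (auto simp: Q_def M_z_conv_mult_op M_cnj_z_conv_mult_op intro!: continuous_intros)
  have "Q (\<lambda>z. of_real (p z))"
    using p
  proof induction
    case (linear p)
    let ?a = "(of_real (p 1) - \<i> * of_real (p \<i>)) / 2" and ?b = "(of_real (p 1) + \<i> * of_real (p \<i>)) / 2"
    have "of_real (p z) = ?a * z + ?b * cnj z" for z
    proof -
      have "z = Re z *\<^sub>R 1 + Im z *\<^sub>R \<i>" by (simp add: complex_eq_iff)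
      then have "p z = p (Re z *\<^sub>R 1 + Im z *\<^sub>R \<i>)" by simp
      also have "\<dots> = Re z * p 1 + Im z * p \<i>"
        using bounded_linear.linear[OF linear] by (simp only: linear_add linear_scale real_scaleR_def)
      finally show ?thesis by (simp add: complex_eq_iff field_simps)
    qed
    then have "(\<lambda>z. of_real (p z)) = (\<lambda>z. ?a * z + ?b * cnj z)" by blast
    moreover have "Q (\<lambda>z. ?a * z + ?b * cnj z)" by (intro Q_add Q_mult Q_const Q_z Q_cnj)
    ultimately show ?case by (simp only:)
  next
    case (const c)
    show ?case by (rule Q_const)
  next
    case (add p q)
    then show ?case using Q_add by simp
  next
    case (mult p q)
    then show ?case using Q_mult by simp
  qed
  then show ?thesis by (simp add: Q_def)
qed

text \<open>\<open>C\<close> preserves the integral of \<open>|f|\<^sup>2\<close> against every polynomial weight, hence \<open>|f|\<^sup>2\<close> itself.\<close>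

lemma conjugation_norm_AE:
  fixes C :: "'h::separable_chilbert_space L2 \<Rightarrow> 'h L2"
  assumes C: "conjugation C" and z: "M_z \<circ> C = C \<circ> M_cnj_z"
  shows "AE z in circle_measure. norm (rep_L2 (C f) z) = norm (rep_L2 f z)"
proof -
  have anti: "antilinear C" and CC: "C (C f) = f" and iso: "cinner (C f) (C g) = cinner g f" for f g
    using C by (auto simp: conjugation_def fun_eq_iff)
  have cz: "C (M_cnj_z f) = M_z (C f)" for f using z by (simp add: fun_eq_iff)
  \<comment> \<open>Conjugating the relation by \<open>C\<close> exchanges \<open>z\<close> and \<open>cnj z\<close>.\<close>
  have zC: "C (M_z f) = M_cnj_z (C f)" for f
    using cz[of "C f"] by (metis CC)
  let ?G = "\<lambda>z. (norm (rep_L2 (C f) z))\<^sup>2 - (norm (rep_L2 f z))\<^sup>2"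
  have int: "integrable circle_measure (\<lambda>z. (norm (rep_L2 g z))\<^sup>2)" for g :: "'h L2"
    using square_integrable_rep_L2[of g] by (simp add: square_integrable_def)
  have "AE z in circle_measure. ?G z = 0"
  proof (rule AE_circle_eq_0_if_orthogonal_to_polynomials)
    show "integrable circle_measure ?G" using int by simp
    fix p :: "complex \<Rightarrow> real" assume p: "real_polynomial_function p"
    let ?p = "\<lambda>z. complex_of_real (p z)"
    have pc: "continuous_on (sphere 0 1) ?p"
      using p by (intro continuous_intros) (simp add: continuous_on_polymonial_function real_polynomial_function_eq)
    have ae: "AE z in circle_measure. inner (rep_L2 (mult_op ?p g) z) (rep_L2 g z) = p z * (norm (rep_L2 g z))\<^sup>2"
      for g :: "'h L2"
      using rep_mult_op[OF pc, of g] by eventually_elim (simp add: scaleC_of_real power2_norm_eq_inner)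
    have int_p: "integrable circle_measure (\<lambda>z. inner (rep_L2 (mult_op ?p g) z) (rep_L2 g z))" for g :: "'h L2"
      by (intro integrable_inner square_integrable_rep_L2)
    have meas: "(\<lambda>z. p z * (norm (rep_L2 g z))\<^sup>2) \<in> borel_measurable circle_measure" for g :: "'h L2"
      by (rule borel_measurable_circle_cong_AE[OF borel_measurable_integrable[OF int_p] ae])
    have inner_mult: "inner (mult_op ?p g) g = (LINT z|circle_measure. p z * (norm (rep_L2 g z))\<^sup>2)"
      for g :: "'h L2"
      unfolding inner_L2_def by (intro integral_cong_AE ae meas borel_measurable_integrable[OF int_p])
    have int_p': "integrable circle_measure (\<lambda>z. p z * (norm (rep_L2 g z))\<^sup>2)" for g :: "'h L2"
      using int_p[of g] integrable_cong_AE[OF borel_measurable_integrable[OF int_p] meas ae] by blast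
    \<comment> \<open>Commutation moves the real multiplier inside \<open>C\<close>, and then \<open>C\<close> drops out as an isometry.\<close>
    have "inner (mult_op ?p (C f)) (C f) = inner (C (mult_op ?p f)) (C f)"
      by (simp only: intertwining_extends_to_polynomials[OF anti zC cz p])
    also have "\<dots> = inner (mult_op ?p f) f" by (simp add: Re_cinner[symmetric] iso) (simp add: Re_cinner inner_commute)
    finally show "(LINT z|circle_measure. p z * ?G z) = 0"
      by (simp add: inner_mult right_diff_distrib int_p')
  qed
  then show ?thesis by eventually_elim simp
qed

lemma countable_dense_closure_exists:
  obtains D :: "'a::second_countable_topology set" where "countable D" "closure D = UNIV"
proof -
  obtain D :: "'a set" where D: "countable D" "\<And>U. open U \<Longrightarrow> U \<noteq> {} \<Longrightarrow> \<exists>d\<in>D. d \<in> U"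
    using countable_dense_exists by blast
  have "x \<in> closure D" for x
    unfolding closure_iff_nhds_not_empty using D(2) by (metis disjoint_iff empty_iff subsetD)
  with D(1) show thesis by (intro that) auto
qed

text \<open>Since \<open>C\<close> is a pointwise isometry, its values on the constant functions with values in a countable
  dense set determine it almost everywhere.\<close>

lemma conjugation_eq_pointwise_op:
  fixes C :: "'h::separable_chilbert_space L2 \<Rightarrow> 'h L2"
  assumes C: "conjugation C" and z: "M_z \<circ> C = C \<circ> M_cnj_z"
  shows "\<exists>C0. Linf_LA C0 \<and> C = pointwise_op C0 \<and> (AE z in circle_measure. conjugation (C0 z))"
proof -
  have C_add: "C (f + g) = C f + C g" and C_sc: "C (a *\<^sub>C f) = cnj a *\<^sub>C C f" and CC: "C (C f) = f"
    for f g a using C by (auto simp: conjugation_def antilinear_def fun_eq_iff)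
  have C_diff: "C (f - g) = C f - C g" for f g
    using C_add[of f "(-1) *\<^sub>C g"] C_sc[of "-1" g] by simp
  obtain D :: "'h set" where D: "countable D" "closure D = UNIV"
    by (rule countable_dense_closure_exists)
  obtain R :: "complex set" where R: "countable R" "closure R = UNIV"
    by (rule countable_dense_closure_exists)
  define Q where "Q = {0, 1} \<union> R"
  have Q: "countable Q" "closure Q = UNIV" "0 \<in> Q" "1 \<in> Q"
    using R closure_mono[of R Q] by (auto simp: Q_def)
  define e where "e x = abs_L2 (\<lambda>_. x :: 'h)" for x
  have rep_e: "AE z in circle_measure. rep_L2 (e x) z = x" for x
    unfolding e_def by (rule rep_abs_L2[OF square_integrable_const])
  \<comment> \<open>\<open>T z\<close> is only meaningful on countably many vectors at once: each \<open>C (e x)\<close> has its own null set.\<close>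
  define T where "T z x = rep_L2 (C (e x)) z" for z x
  have T_rel: "AE z in circle_measure. norm (cnj q *\<^sub>C T z x + cnj r *\<^sub>C T z y - T z w) = norm (q *\<^sub>C x + r *\<^sub>C y - w)"
    for q r x y w
  proof -
    let ?f = "q *\<^sub>C e x + r *\<^sub>C e y - e w"
    have Cf: "C ?f = cnj q *\<^sub>C C (e x) + cnj r *\<^sub>C C (e y) - C (e w)"
      by (simp only: C_add C_diff C_sc)
    show ?thesis
      using conjugation_norm_AE[OF C z, of ?f, unfolded Cf]
        rep_L2_diff[of "q *\<^sub>C e x + r *\<^sub>C e y" "e w"] rep_L2_add[of "q *\<^sub>C e x" "r *\<^sub>C e y"]
        rep_L2_scaleC[of q "e x"] rep_L2_scaleC[of r "e y"] rep_e[of x] rep_e[of y] rep_e[of w]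
        rep_L2_diff[of "cnj q *\<^sub>C C (e x) + cnj r *\<^sub>C C (e y)" "C (e w)"]
        rep_L2_add[of "cnj q *\<^sub>C C (e x)" "cnj r *\<^sub>C C (e y)"]
        rep_L2_scaleC[of "cnj q" "C (e x)"] rep_L2_scaleC[of "cnj r" "C (e y)"]
      by eventually_elim (simp add: T_def)
  qed
  define good where "good z \<longleftrightarrow> (\<forall>q\<in>Q. \<forall>r\<in>Q. \<forall>x\<in>D. \<forall>y\<in>D. \<forall>w\<in>D.
      norm (cnj q *\<^sub>C T z x + cnj r *\<^sub>C T z y - T z w) = norm (q *\<^sub>C x + r *\<^sub>C y - w))" for z
  have good: "AE z in circle_measure. good z"
    unfolding good_def by (intro AE_ball_countable' D Q T_rel)
  define is_ext where "is_ext z T' \<longleftrightarrow> antilinear T' \<and> (\<forall>x. norm (T' x) = norm x) \<and> (\<forall>x\<in>D. T' x = T z x)" for z T'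
  have ex: "\<exists>T'. is_ext z T'" if "good z" for z
    unfolding is_ext_def by (rule antilinear_isometry_extension[OF Q(2-4) D(2)]) (use that in \<open>simp add: good_def\<close>)
  \<comment> \<open>Off the good points any bounded antilinear map will do, as they form a null set.\<close>
  define C0 where "C0 z = (if good z then SOME T'. is_ext z T' else (\<lambda>_. 0))" for z
  have C0: "is_ext z (C0 z)" if "good z" for z
    using someI_ex[OF ex[OF that]] that by (simp add: C0_def)
  have C0_anti: "antilinear (C0 z)" and C0_norm: "norm (C0 z x) \<le> norm x" for z x
    using C0[of z] by (cases "good z"; simp add: is_ext_def C0_def antilinear_def)+
  have C0_lin: "bounded_antilinear (C0 z)" for z
    unfolding bounded_antilinear_def using C0_anti[of z] C0_norm[of z] by (auto intro!: exI[of _ 1])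
  \<comment> \<open>The isometry property for \<open>f - e x\<close> gives the distance of \<open>(C f)(z)\<close> from every \<open>C0 z x\<close> with \<open>x\<close> in
    \<open>D\<close>; letting \<open>x\<close> tend to \<open>f(z)\<close> identifies \<open>(C f)(z)\<close>.\<close>
  have rep_C: "AE z in circle_measure. rep_L2 (C f) z = C0 z (rep_L2 f z)" for f
  proof -
    have "AE z in circle_measure. norm (rep_L2 (C f) z - T z x) = norm (rep_L2 f z - x)" for x
      using conjugation_norm_AE[OF C z, of "f - e x", unfolded C_diff] rep_L2_diff[of f "e x"]
        rep_L2_diff[of "C f" "C (e x)"] rep_e[of x]
      by eventually_elim (simp add: T_def)
    then have "AE z in circle_measure. \<forall>x\<in>D. norm (rep_L2 (C f) z - T z x) = norm (rep_L2 f z - x)"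
      by (intro AE_ball_countable' D)
    then show ?thesis
      using good
    proof eventually_elim
      case (elim z)
      have cont: "continuous_on UNIV (C0 z)"
        by (intro linear_continuous_on bounded_antilinear_imp_bounded_linear C0_lin)
      have "norm (rep_L2 (C f) z - C0 z x) - norm (rep_L2 f z - x) = 0" for x
      proof (rule continuous_constant_on_closure[where S = D and a = 0
            and f = "\<lambda>x. norm (rep_L2 (C f) z - C0 z x) - norm (rep_L2 f z - x)"])
        show "continuous_on (closure D) (\<lambda>x. norm (rep_L2 (C f) z - C0 z x) - norm (rep_L2 f z - x))"
          unfolding D(2) by (intro continuous_intros cont)
        show "norm (rep_L2 (C f) z - C0 z x) - norm (rep_L2 f z - x) = 0" if "x \<in> D" for x
          using elim(1) C0[OF elim(2)] that by (simp add: is_ext_def)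
      qed (simp add: D(2))
      from this[of "rep_L2 f z"] show ?case by simp
    qed
  qed
  have Linf: "Linf_LA C0"
    unfolding Linf_LA_def
  proof (intro conjI ballI allI)
    show "bounded_antilinear (C0 z)" for z by (rule C0_lin)
    show "\<exists>K. AE z in circle_measure. onorm (C0 z) \<le> K"
      by (intro exI[of _ 1] AE_I2 onorm_bound) (use C0_norm in auto)
    fix x
    have "AE z in circle_measure. rep_L2 (C (e x)) z = C0 z x"
      using rep_C[of "e x"] rep_e[of x] by eventually_elim simp
    then show "(\<lambda>z. C0 z x) \<in> borel_measurable circle_measure"
      by (rule borel_measurable_circle_cong_AE[OF square_integrable_measurable[OF square_integrable_rep_L2]])
  qed
  have "C = pointwise_op C0"
  proof
    fix f
    show "C f = pointwise_op C0 f" by (rule pointwise_op_eqI) (rule rep_C)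
  qed
  moreover have "AE z in circle_measure. conjugation (C0 z)"
  proof -
    have "AE z in circle_measure. C0 z (C0 z x) = x" for x
      using rep_C[of "C (e x)", unfolded CC] rep_C[of "e x"] rep_e[of x] by eventually_elim simp
    then have "AE z in circle_measure. \<forall>x\<in>D. C0 z (C0 z x) = x"
      by (intro AE_ball_countable' D)
    then show ?thesis
      using good
    proof eventually_elim
      case (elim z)
      have cont: "continuous_on UNIV (C0 z)"
        by (intro linear_continuous_on bounded_antilinear_imp_bounded_linear C0_lin)
      have "C0 z (C0 z x) - x = 0" for x
      proof (rule continuous_constant_on_closure[where S = D and a = 0 and f = "\<lambda>x. C0 z (C0 z x) - x"])
        show "continuous_on (closure D) (\<lambda>x. C0 z (C0 z x) - x)"
          unfolding D(2) by (intro continuous_intros continuous_on_compose2[OF cont cont]) simp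
        show "C0 z (C0 z x) - x = 0" if "x \<in> D" for x
          using elim(1) that by simp
      qed (simp add: D(2))
      then show ?case
        using C0[OF elim(2)] by (intro antilinear_isometry_conjugation) (auto simp: is_ext_def)
    qed
  qed
  ultimately show ?thesis using Linf by blast
qed

text \<open>Antilinearity of \<open>C0 z\<close> turns the scalar \<open>cnj z\<close> into \<open>z\<close>; the rest integrates pointwise identities.\<close>

lemma pointwise_op_conjugation:
  fixes C0 :: "complex \<Rightarrow> 'h::separable_chilbert_space \<Rightarrow> 'h"
  assumes Linf: "Linf_LA C0" and conj: "AE z in circle_measure. conjugation (C0 z)"
    and anti: "antilinear (pointwise_op C0)"
  shows "conjugation (pointwise_op C0)" and "M_z \<circ> pointwise_op C0 = pointwise_op C0 \<circ> M_cnj_z"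
proof -
  note rep = rep_pointwise_op[OF disjI2[OF Linf]]
  have "pointwise_op C0 (pointwise_op C0 f) = f" for f
    by (rule L2_eqI, use rep[of "pointwise_op C0 f"] rep[of f] conj in eventually_elim)
      (simp add: conjugation_def fun_eq_iff)
  moreover have "cinner (pointwise_op C0 f) (pointwise_op C0 g) = cinner g f" for f g
    unfolding cinner_L2_def
  proof (rule integral_cong_AE)
    show "AE z in circle_measure. cinner (rep_L2 (pointwise_op C0 f) z) (rep_L2 (pointwise_op C0 g) z)
        = cinner (rep_L2 g z) (rep_L2 f z)"
      using rep[of f] rep[of g] conj by eventually_elim (simp add: conjugation_def)
  qed (intro borel_measurable_integrable integrable_cinner square_integrable_rep_L2)+
  ultimately show "conjugation (pointwise_op C0)"
    using anti by (auto simp: conjugation_def fun_eq_iff)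
  have "M_z (pointwise_op C0 f) = pointwise_op C0 (M_cnj_z f)" for f
  proof (rule L2_eqI)
    have cont: "continuous_on (sphere 0 1) (\<lambda>z. z)" "continuous_on (sphere 0 1) cnj"
      by (intro continuous_intros)+
    show "AE z in circle_measure. rep_L2 (M_z (pointwise_op C0 f)) z = rep_L2 (pointwise_op C0 (M_cnj_z f)) z"
      unfolding M_z_conv_mult_op M_cnj_z_conv_mult_op
      using rep[of f] rep[of "mult_op cnj f"] rep_mult_op[OF cont(1), of "pointwise_op C0 f"]
        rep_mult_op[OF cont(2), of f] conj
      by eventually_elim (simp add: conjugation_def antilinear_def)
  qed
  then show "M_z \<circ> pointwise_op C0 = pointwise_op C0 \<circ> M_cnj_z" by (simp add: fun_eq_iff)
qed

section \<open>Factorization through a fixed conjugation\<close>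

text \<open>The adjoint of a product of two conjugations is the product in the opposite order, which is also
  its inverse and its conjugate under \<open>J\<close>.\<close>

lemma conjugation_comp:
  fixes J K :: "'h::chilbert_space \<Rightarrow> 'h"
  assumes J: "conjugation J" and K: "conjugation K"
  shows "cadjoint (J \<circ> K) = K \<circ> J" and "unitary_op (J \<circ> K)" and "C_symmetric J (J \<circ> K)"
proof -
  have JJ: "J (J x) = x" and KK: "K (K x) = x" for x
    using J K by (auto simp: conjugation_def fun_eq_iff)
  have "cinner (J (K x)) y = cinner x (K (J y))" for x y
    using J K JJ[of y] KK[of "J y"] unfolding conjugation_def by metis
  then show adj: "cadjoint (J \<circ> K) = K \<circ> J" by (intro cadjoint_eqI) simp
  have lin: "bounded_clinear (J \<circ> K)"
  proof -
    have "bounded_linear J" "bounded_linear K"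
      using J K by (auto intro!: bounded_antilinear_imp_bounded_linear conjugation_imp_bounded_antilinear)
    then have "bounded_linear (J \<circ> K)" unfolding comp_def by (rule bounded_linear_compose)
    then show ?thesis using J K by (simp add: bounded_clinear_def conjugation_def antilinear_def)
  qed
  then show "unitary_op (J \<circ> K)" "C_symmetric J (J \<circ> K)"
    by (auto simp: unitary_op_def C_symmetric_def adj fun_eq_iff JJ KK)
qed

lemma onorm_isometry_comp:
  assumes "\<And>x. norm (J x) = norm x" shows "onorm (J \<circ> A) = onorm A"
  by (simp add: onorm_def assms)

text \<open>Where \<open>C0 z\<close> is a conjugation, \<open>U z\<close> is a product of two conjugations with adjoint \<open>C0 z \<circ> J\<close>, and
  \<open>J \<circ> J = id\<close> cancels in both factorizations.\<close>

lemma pointwise_op_factorization: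
  fixes C0 :: "complex \<Rightarrow> 'h::separable_chilbert_space \<Rightarrow> 'h"
  assumes Linf: "Linf_LA C0" and conj: "AE z in circle_measure. conjugation (C0 z)" and J: "conjugation J"
  defines "U \<equiv> \<lambda>z. J \<circ> C0 z"
  shows "Linf_L U"
    and "AE z in circle_measure. unitary_op (U z) \<and> C_symmetric J (U z)"
    and "pointwise_op C0 = J_tilde J \<circ> pointwise_op U"
    and "pointwise_op C0 = pointwise_op (\<lambda>z. cadjoint (U z)) \<circ> J_tilde J"
proof -
  have JJ: "J (J x) = x" for x using J by (simp add: conjugation_def fun_eq_iff)
  have J_lin: "bounded_linear J"
    using J by (intro bounded_antilinear_imp_bounded_linear conjugation_imp_bounded_antilinear)
  have J_norm: "norm (J x) = norm x" for x by (rule conjugation_norm[OF J])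
  show LU: "Linf_L U"
    unfolding Linf_L_def
  proof (intro conjI ballI allI)
    fix z :: complex assume "z \<in> sphere 0 1"
    then have K: "bounded_antilinear (C0 z)" using Linf by (simp add: Linf_LA_def)
    have "bounded_linear (J \<circ> C0 z)"
      unfolding comp_def
      by (rule bounded_linear_compose[OF J_lin bounded_antilinear_imp_bounded_linear[OF K]])
    then show "bounded_clinear (U z)"
      using J K by (simp add: U_def bounded_clinear_def conjugation_def bounded_antilinear_def antilinear_def)
  next
    fix x
    have "(\<lambda>z. C0 z x) \<in> borel_measurable circle_measure" using Linf by (simp add: Linf_LA_def)
    then show "(\<lambda>z. U z x) \<in> borel_measurable circle_measure"
      unfolding U_def comp_def by (rule measurable_bounded_linear_comp[OF J_lin])
  next
    show "\<exists>K. AE z in circle_measure. onorm (U z) \<le> K"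
      using Linf unfolding U_def onorm_isometry_comp[OF J_norm] by (simp add: Linf_LA_def)
  qed
  show "AE z in circle_measure. unitary_op (U z) \<and> C_symmetric J (U z)"
    using conj by eventually_elim (simp add: U_def conjugation_comp[OF J])
  show "pointwise_op C0 = J_tilde J \<circ> pointwise_op U"
  proof
    fix f
    show "pointwise_op C0 f = (J_tilde J \<circ> pointwise_op U) f"
      by (rule L2_eqI, use rep_pointwise_op[OF disjI2[OF Linf], of f]
          rep_pointwise_op[OF disjI1[OF LU], of f] rep_J_tilde[OF J, of "pointwise_op U f"] in eventually_elim)
        (simp add: U_def JJ)
  qed
  show "pointwise_op C0 = pointwise_op (\<lambda>z. cadjoint (U z)) \<circ> J_tilde J"
  proof
    fix f
    have "AE z in circle_measure. rep_L2 (pointwise_op C0 f) z = cadjoint (U z) (rep_L2 (J_tilde J f) z)"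
      using rep_pointwise_op[OF disjI2[OF Linf], of f] rep_J_tilde[OF J, of f] conj
      by eventually_elim (simp add: U_def conjugation_comp(1)[OF J] JJ)
    then show "pointwise_op C0 f = (pointwise_op (\<lambda>z. cadjoint (U z)) \<circ> J_tilde J) f"
      by (simp add: pointwise_op_eqI)
  qed
qed

text \<open>Symmetry gives \<open>J U J = U\<^sup>*\<close>, so that \<open>(J U)\<^sup>2 = U\<^sup>* U\<close> is the identity.\<close>

lemma conjugation_of_factorization:
  fixes U :: "complex \<Rightarrow> 'h::separable_chilbert_space \<Rightarrow> 'h"
  assumes J: "conjugation J" and U: "Linf_L U"
    and sym: "AE z in circle_measure. unitary_op (U z) \<and> C_symmetric J (U z)"
  defines "C0 \<equiv> \<lambda>z. J \<circ> U z"
  shows "Linf_LA C0" and "J_tilde J \<circ> pointwise_op U = pointwise_op C0"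
    and "AE z in circle_measure. conjugation (C0 z)"
proof -
  have J_lin: "bounded_linear J"
    using J by (intro bounded_antilinear_imp_bounded_linear conjugation_imp_bounded_antilinear)
  have J_norm: "norm (J x) = norm x" for x by (rule conjugation_norm[OF J])
  show L: "Linf_LA C0"
    unfolding Linf_LA_def
  proof (intro conjI ballI allI)
    fix z :: complex assume "z \<in> sphere 0 1"
    then have K: "bounded_clinear (U z)" using U by (simp add: Linf_L_def)
    then have "bounded_linear (J \<circ> U z)"
      unfolding comp_def bounded_clinear_def by (blast intro: bounded_linear_compose[OF J_lin])
    then have "\<exists>B. \<forall>x. norm ((J \<circ> U z) x) \<le> B * norm x"
      using bounded_linear.bounded[of "J \<circ> U z"] by (metis mult.commute)
    then show "bounded_antilinear (C0 z)"
      using J K linear_add[OF bounded_linear.linear, of "U z"]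
      by (simp add: C0_def bounded_clinear_def conjugation_def bounded_antilinear_def antilinear_def)
  next
    fix x
    have "(\<lambda>z. U z x) \<in> borel_measurable circle_measure" using U by (simp add: Linf_L_def)
    then show "(\<lambda>z. C0 z x) \<in> borel_measurable circle_measure"
      unfolding C0_def comp_def by (rule measurable_bounded_linear_comp[OF J_lin])
  next
    show "\<exists>K. AE z in circle_measure. onorm (C0 z) \<le> K"
      using U unfolding C0_def onorm_isometry_comp[OF J_norm] by (simp add: Linf_L_def)
  qed
  show "J_tilde J \<circ> pointwise_op U = pointwise_op C0"
  proof
    fix f
    show "(J_tilde J \<circ> pointwise_op U) f = pointwise_op C0 f"
      by (rule L2_eqI, use rep_pointwise_op[OF disjI2[OF L], of f]
          rep_pointwise_op[OF disjI1[OF U], of f] rep_J_tilde[OF J, of "pointwise_op U f"] in eventually_elim)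
        (simp add: C0_def)
  qed
  show "AE z in circle_measure. conjugation (C0 z)"
    using sym AE_space
  proof eventually_elim
    case (elim z)
    have lin: "bounded_clinear (U z)" and UU: "cadjoint (U z) (U z x) = x"
      and JUJ: "J (U z (J x)) = cadjoint (U z) x" for x
      using elim by (auto simp: unitary_op_def C_symmetric_def fun_eq_iff)
    have "antilinear (C0 z)"
      using L elim(2) by (simp add: Linf_LA_def bounded_antilinear_def)
    moreover have "C0 z (C0 z x) = x" for x by (simp add: C0_def JUJ UU)
    moreover have "cinner (C0 z x) (C0 z y) = cinner y x" for x y
      using J cinner_cadjoint[OF lin, of y "U z x"] by (simp add: C0_def conjugation_def UU)
    ultimately show ?case by (simp add: conjugation_def fun_eq_iff)
  qed
qed

section \<open>The equivalence\<close>

theorem theorem4p8: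
  fixes C :: "'h::separable_chilbert_space L2 \<Rightarrow> 'h L2"
  assumes "antilinear C"
  shows "((conjugation C \<and> M_z \<circ> C = C \<circ> M_cnj_z) \<longleftrightarrow>
          (\<exists>C0. Linf_LA C0 \<and> C = pointwise_op C0 \<and>
             (AE z in circle_measure. conjugation (C0 z)))) \<and>
         ((\<exists>C0. Linf_LA C0 \<and> C = pointwise_op C0 \<and>
             (AE z in circle_measure. conjugation (C0 z))) \<longleftrightarrow>
          (\<forall>J. conjugation J \<longrightarrow>
             (\<exists>U. Linf_L U \<and>
                (AE z in circle_measure. unitary_op (U z) \<and> C_symmetric J (U z)) \<and>
                C = J_tilde J \<circ> pointwise_op U \<and>
                C = pointwise_op (\<lambda>z. cadjoint (U z)) \<circ> J_tilde J)))"
    (is "(?one \<longleftrightarrow> ?two) \<and> (?two \<longleftrightarrow> ?three)")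
proof (intro conjI iffI)
  show ?two if ?one using conjugation_eq_pointwise_op that by blast
  show "conjugation C" "M_z \<circ> C = C \<circ> M_cnj_z" if ?two
    using that pointwise_op_conjugation assms by blast+
  show ?three if ?two
  proof (intro allI impI)
    fix J :: "'h \<Rightarrow> 'h" assume J: "conjugation J"
    from that obtain C0 where C0: "Linf_LA C0" "C = pointwise_op C0" "AE z in circle_measure. conjugation (C0 z)"
      by blast
    show "\<exists>U. Linf_L U \<and>
        (AE z in circle_measure. unitary_op (U z) \<and> C_symmetric J (U z)) \<and>
        C = J_tilde J \<circ> pointwise_op U \<and>
        C = pointwise_op (\<lambda>z. cadjoint (U z)) \<circ> J_tilde J"
      unfolding C0(2)
      by (intro exI[of _ "\<lambda>z. J \<circ> C0 z"] conjI pointwise_op_factorization[OF C0(1,3) J])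
  qed
  show ?two if ?three
  proof -
    obtain J :: "'h \<Rightarrow> 'h" where J: "conjugation J" using conjugation_exists by blast
    with that obtain U where U: "Linf_L U"
      "AE z in circle_measure. unitary_op (U z) \<and> C_symmetric J (U z)" "C = J_tilde J \<circ> pointwise_op U"
      by blast
    show ?two
      unfolding U(3) by (intro exI[of _ "\<lambda>z. J \<circ> U z"] conjI conjugation_of_factorization[OF J U(1,2)])
  qed
qed

end
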